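(* For $b\le 3.06$, $$\min_{z\in\overline{\mathcal{D}_{\mathcal{G}}}}\big(\zeta(6,z)-b\zeta(3,z)\big)=\min_{z\in\Gamma_b}\big(\zeta(6,z)-b\zeta(3,z)\big).$$
   Context: For $s>1$ and $z\in\mathbb{H}=\{\Im z>0\}$, $\zeta(s,z)=\sum_{(m,n)\in\mathbb{Z}^2\setminus\{0\}}\frac{(\Im z)^s}{|mz+n|^{2s}}$. $\mathcal{D}_{\mathcal{G}}=\{z\in\mathbb{H}: |z|>1,\ 0<\Re z<\frac12\}$. $\Gamma_b=\{z\in\mathbb{H}: |z|=1,\ \Im z\in[\frac{\sqrt3}{2},1]\}$. *)

theory Defs
  imports "HOL-Analysis.Analysis"
begin

definition lattice_zeta :: "real \<Rightarrow> complex \<Rightarrow> real" where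
  "lattice_zeta s z =
     (\<Sum>\<^sub>\<infinity>(m, n) \<in> (UNIV :: (int \<times> int) set) - {(0, 0)}.
        (Im z) powr s / (cmod (of_int m * z + of_int n)) powr (2 * s))"

definition D_G :: "complex set" where
  "D_G = {z. Im z > 0 \<and> cmod z > 1 \<and> 0 < Re z \<and> Re z < 1/2}"

definition Gamma_b :: "complex set" where
  "Gamma_b = {z. Im z > 0 \<and> cmod z = 1 \<and> sqrt 3 / 2 \<le> Im z \<and> Im z \<le> 1}"

end

theory Submission
  imports Defs
begin

text \<open>
  On a ray \<open>z = e\<^sup>t w\<close> with \<open>|w| = 1\<close>, replacing \<open>t\<close> by \<open>- t\<close> amounts to exchanging \<open>m\<close> and \<open>n\<close> in the lattice
  sums. Hence \<open>f = \<zeta>(6, \<cdot>) - b \<zeta>(3, \<cdot>)\<close> is even in \<open>t\<close>, and \<open>f (z) \<ge> f (z / |z|)\<close> follows once \<open>f\<close> is convex in \<open>t\<close>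
  on the part of the ray in the closure of the domain. The second derivative is affine in \<open>b\<close>, so it suffices
  that it is nonnegative for \<open>\<zeta>(3, \<cdot>)\<close> and for \<open>b = 3.06\<close>.

  In the coordinates \<open>u = |z|\<^sup>2 - 1 \<ge> 0\<close> and \<open>v = 1 - 2 Re z \<in> [0, 1]\<close> the critical point is the hexagonal lattice
  \<open>u = v = 0\<close>: there convexity fails for \<open>b > 3.0612\<close>, while away from it the second derivative grows at least
  linearly in \<open>u\<close> and \<open>v\<close>. The lattice points on the axes and diagonals are treated exactly; every other point is
  estimated by its value at the hexagonal lattice plus a linear function of \<open>u\<close> and \<open>v\<close>. All estimates are
  made for the partial sums over squares and are uniform in the size of the square.
\<close>

section \<open>Second radial derivatives of the summands\<close>

text \<open>With \<open>y\<close> the height and \<open>S3\<close>, \<open>S6\<close> the box sums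
  of \<open>curv\<close>, the second derivative is \<open>y ^ 3 * (y ^ 3 * S6 - b * S3)\<close>.
  Since \<open>3.06\<close> lies within 0.04 percent of the failure point, every constant must be
  accurate to about four digits at the hexagonal point: \<open>0.64967\<close> is just below
  \<open>(3/4) powr (3/2) * (1 + 1 / 2 ^ 12)\<close>, where the bracket is the start of zeta(12),
  and \<open>3.1132\<close> is just above \<open>3.06\<close> times zeta(6). Away from that point
  the slopes in \<open>u\<close> and \<open>v\<close> leave ample room, which is why crude linear
  bounds suffice there. A cheap global bound usually handles large \<open>u + v\<close>, and first
  order expansion handles small \<open>u + v\<close>.

  Working with finite boxes avoids termwise differentiation of infinite series: only the final
  inequality between the two ends of a ray is passed to the limit. The points \<open>(m, n)\<close>
  and \<open>(n, m)\<close> lie in the same box, so the symmetry in \<open>t\<close> survives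
  truncation.\<close>

text \<open>With \<open>\<rho> = |z|\<^sup>2\<close> and \<open>\<tau> = 2 Re z\<close> we have \<open>|m z + n|\<^sup>2 = \<rho> m\<^sup>2 + \<tau> m n + n\<^sup>2\<close>. Up to a factor
  depending on \<open>z\<close> only, \<open>curv s \<rho> \<tau> m n\<close> is the second derivative of \<open>(Im z / |m z + n|\<^sup>2) ^ s\<close>
  with respect to \<open>t = ln |z|\<close>.\<close>

definition curv :: "nat \<Rightarrow> real \<Rightarrow> real \<Rightarrow> real \<Rightarrow> real \<Rightarrow> real" where
  "curv s \<rho> \<tau> m n =
     real s * (real s + 1) * (\<rho> * m\<^sup>2 - n\<^sup>2)\<^sup>2 / (\<rho> * m\<^sup>2 + n\<^sup>2 + \<tau> * m * n) ^ (s + 2)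
     - real s * (\<rho> * m\<^sup>2 + n\<^sup>2) / (\<rho> * m\<^sup>2 + n\<^sup>2 + \<tau> * m * n) ^ (s + 1)"

lemma curv_scale:
  assumes "c \<noteq> 0"
  shows "curv s \<rho> \<tau> (c * m) (c * n) = curv s \<rho> \<tau> m n / c ^ (2 * s)"
proof -
  let ?q = "\<rho> * m\<^sup>2 + n\<^sup>2 + \<tau> * m * n"
  have e: "\<rho> * (c * m)\<^sup>2 - (c * n)\<^sup>2 = c\<^sup>2 * (\<rho> * m\<^sup>2 - n\<^sup>2)"
    "\<rho> * (c * m)\<^sup>2 + (c * n)\<^sup>2 = c\<^sup>2 * (\<rho> * m\<^sup>2 + n\<^sup>2)"
    "\<rho> * (c * m)\<^sup>2 + (c * n)\<^sup>2 + \<tau> * (c * m) * (c * n) = c\<^sup>2 * ?q"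
    by (simp_all add: power2_eq_square algebra_simps)
  have f: "(c\<^sup>2)\<^sup>2 / (c\<^sup>2) ^ (s + 2) = 1 / c ^ (2 * s)" "c\<^sup>2 / (c\<^sup>2) ^ (s + 1) = 1 / c ^ (2 * s)"
    using assms by (simp_all add: power_add power_mult)
  have "\<alpha> * (c\<^sup>2 * D)\<^sup>2 / (c\<^sup>2 * q) ^ (s + 2) - \<beta> * (c\<^sup>2 * M) / (c\<^sup>2 * q) ^ (s + 1)
      = (\<alpha> * D\<^sup>2 / q ^ (s + 2) - \<beta> * M / q ^ (s + 1)) / c ^ (2 * s)" for \<alpha> \<beta> D M q :: real
  proof -
    have "\<alpha> * (c\<^sup>2 * D)\<^sup>2 / (c\<^sup>2 * q) ^ (s + 2) - \<beta> * (c\<^sup>2 * M) / (c\<^sup>2 * q) ^ (s + 1)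
      = \<alpha> * D\<^sup>2 / q ^ (s + 2) * ((c\<^sup>2)\<^sup>2 / (c\<^sup>2) ^ (s + 2)) - \<beta> * M / q ^ (s + 1) * (c\<^sup>2 / (c\<^sup>2) ^ (s + 1))"
      unfolding power_mult_distrib by (simp add: mult_ac)
    then show ?thesis unfolding f by (simp add: diff_divide_distrib)
  qed
  then show ?thesis unfolding curv_def e(3) unfolding e(1,2) .
qed

lemma curv_minus: "curv s \<rho> \<tau> (- m) (- n) = curv s \<rho> \<tau> m n"
  by (simp add: curv_def)

text \<open>Since \<open>(rho m^2 - n^2)^2 = (rho m^2 + n^2)^2 - 4 rho (m n)^2\<close>, only
  \<open>q\<close>, \<open>m n\<close>, \<open>tau\<close> and the squared height remain. The last
  two have one-sided bounds that are sharp at the hexagonal point.\<close>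

lemma curv_3:
  assumes "q = \<rho> * m\<^sup>2 + n\<^sup>2 + \<tau> * m * n" "q \<noteq> 0"
  shows "curv 3 \<rho> \<tau> m n =
    9 / q ^ 3 - 21 * \<tau> * (m * n) / q ^ 4 - 48 * (m * n)\<^sup>2 * (\<rho> - \<tau>\<^sup>2 / 4) / q ^ 5"
proof -
  have a: "\<rho> * m\<^sup>2 + n\<^sup>2 = q - \<tau> * (m * n)" using assms by simp
  have b: "(\<rho> * m\<^sup>2 - n\<^sup>2)\<^sup>2 = (q - \<tau> * (m * n))\<^sup>2 - 4 * \<rho> * (m * n)\<^sup>2"
    unfolding a[symmetric] by (simp add: power2_eq_square algebra_simps)
  show ?thesis
    unfolding curv_def assms(1)[symmetric] a b using assms(2)
    by (simp add: field_simps power_numeral_reduce)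
qed

lemma curv_6:
  assumes "q = \<rho> * m\<^sup>2 + n\<^sup>2 + \<tau> * m * n" "q \<noteq> 0"
  shows "curv 6 \<rho> \<tau> m n =
    36 / q ^ 6 - 78 * \<tau> * (m * n) / q ^ 7 - 168 * (m * n)\<^sup>2 * (\<rho> - \<tau>\<^sup>2 / 4) / q ^ 8"
proof -
  have a: "\<rho> * m\<^sup>2 + n\<^sup>2 = q - \<tau> * (m * n)" using assms by simp
  have b: "(\<rho> * m\<^sup>2 - n\<^sup>2)\<^sup>2 = (q - \<tau> * (m * n))\<^sup>2 - 4 * \<rho> * (m * n)\<^sup>2"
    unfolding a[symmetric] by (simp add: power2_eq_square algebra_simps)
  show ?thesis
    unfolding curv_def assms(1)[symmetric] a b using assms(2)
    by (simp add: field_simps power_numeral_reduce)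
qed

text \<open>The identity \<open>curv_3\<close> with \<open>p = - m n\<close>, and with \<open>\<tau>\<close> and \<open>(Im z)\<^sup>2 = \<rho> - \<tau>\<^sup>2 / 4\<close> replaced by their
  values \<open>1\<close> and \<open>3/4\<close> at the hexagonal point.\<close>

definition env3 :: "real \<Rightarrow> real \<Rightarrow> real" where
  "env3 p q = 9 / q ^ 3 + 21 * p / q ^ 4 - 36 * p\<^sup>2 / q ^ 5"

lemma env3_deriv:
  assumes "q > 0"
  shows "(env3 p has_real_derivative (180 * p\<^sup>2 - 84 * p * q - 27 * q\<^sup>2) / q ^ 6) (at q)"
  unfolding env3_def using assms
  by (auto intro!: derivative_eq_intros simp: field_simps power_numeral_reduce)

lemma le_of_deriv_le:
  fixes f :: "real \<Rightarrow> real"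
  assumes "a \<le> b" "\<And>x. a \<le> x \<Longrightarrow> x \<le> b \<Longrightarrow> (f has_real_derivative f' x) (at x)"
    and "\<And>x. a \<le> x \<Longrightarrow> x \<le> b \<Longrightarrow> f' x \<le> L"
  shows "f b \<le> f a + L * (b - a)"
proof (cases "a = b")
  case False
  with assms(1) have "a < b" by simp
  from MVT2[OF this assms(2)] obtain z where "z > a" "z < b" "f b - f a = (b - a) * f' z" by blast
  moreover have "(b - a) * f' z \<le> (b - a) * L"
    using calculation assms(3)[of z] \<open>a < b\<close> by (intro mult_left_mono) auto
  ultimately have "f b - f a \<le> L * (b - a)" by (simp add: mult.commute)
  then show ?thesis by simp
qed simp

lemma le_of_deriv_ge:
  fixes f :: "real \<Rightarrow> real"
  assumes "a \<le> b" "\<And>x. a \<le> x \<Longrightarrow> x \<le> b \<Longrightarrow> (f has_real_derivative f' x) (at x)"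
    and "\<And>x. a \<le> x \<Longrightarrow> x \<le> b \<Longrightarrow> - L \<le> f' x"
  shows "f a \<le> f b + L * (b - a)"
proof -
  have "- f b \<le> - f a + L * (b - a)"
    by (rule le_of_deriv_le[where f' = "\<lambda>x. - f' x"])
       (use assms in \<open>auto intro!: derivative_eq_intros simp: minus_le_iff\<close>)
  then show ?thesis by simp
qed

text \<open>For \<open>p >= 0\<close> the numerator of the derivative decreases in \<open>q\<close>,
  so its positive part at \<open>a\<close>, divided by \<open>a ^ 6\<close>, bounds the slope on the
  whole interval.\<close>

lemma env3_right:
  assumes "0 \<le> p" "0 < a" "a \<le> q"
  shows "env3 p q \<le> env3 p a + max 0 (180 * p\<^sup>2 - 84 * p * a - 27 * a\<^sup>2) / a ^ 6 * (q - a)"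
proof (rule le_of_deriv_le[OF assms(3)])
  fix x assume x: "a \<le> x"
  then show "(env3 p has_real_derivative (180 * p\<^sup>2 - 84 * p * x - 27 * x\<^sup>2) / x ^ 6) (at x)"
    using assms by (intro env3_deriv) simp
  have "180 * p\<^sup>2 - 84 * p * x - 27 * x\<^sup>2 \<le> 180 * p\<^sup>2 - 84 * p * a - 27 * a\<^sup>2"
    using assms x by (intro diff_mono mult_left_mono power_mono) auto
  then have "(180 * p\<^sup>2 - 84 * p * x - 27 * x\<^sup>2) / x ^ 6
      \<le> max 0 (180 * p\<^sup>2 - 84 * p * a - 27 * a\<^sup>2) / x ^ 6"
    using assms x by (intro divide_right_mono) auto
  also have "\<dots> \<le> max 0 (180 * p\<^sup>2 - 84 * p * a - 27 * a\<^sup>2) / a ^ 6"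
    using assms x by (intro divide_left_mono power_mono) auto
  finally show "(180 * p\<^sup>2 - 84 * p * x - 27 * x\<^sup>2) / x ^ 6
      \<le> max 0 (180 * p\<^sup>2 - 84 * p * a - 27 * a\<^sup>2) / a ^ 6" .
qed

text \<open>Dropping the negative term \<open>- 27 q^2\<close> of the numerator leaves an upper
  bound for the slope that decreases in \<open>q\<close>.\<close>

lemma env3_right_neg:
  assumes "0 \<le> h" "0 < a" "a \<le> q"
  shows "env3 (- h) q \<le> env3 (- h) a + (84 * h * a + 180 * h\<^sup>2) / a ^ 6 * (q - a)"
proof (rule le_of_deriv_le[OF assms(3)])
  fix x assume x: "a \<le> x"
  show "(env3 (- h) has_real_derivative (180 * (- h)\<^sup>2 - 84 * (- h) * x - 27 * x\<^sup>2) / x ^ 6) (at x)"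
    using assms x by (intro env3_deriv) simp
  have "(180 * (- h)\<^sup>2 - 84 * (- h) * x - 27 * x\<^sup>2) / x ^ 6 \<le> (180 * h\<^sup>2 + 84 * h * x) / x ^ 6"
    using assms x by (intro divide_right_mono) auto
  also have "\<dots> = 180 * h\<^sup>2 / x ^ 6 + 84 * h / x ^ 5"
    using assms x by (simp add: field_simps power_numeral_reduce)
  also have "\<dots> \<le> 180 * h\<^sup>2 / a ^ 6 + 84 * h / a ^ 5"
    using assms x by (intro add_mono divide_left_mono power_mono) auto
  also have "\<dots> = (84 * h * a + 180 * h\<^sup>2) / a ^ 6"
    using assms by (simp add: field_simps power_numeral_reduce)
  finally show "(180 * (- h)\<^sup>2 - 84 * (- h) * x - 27 * x\<^sup>2) / x ^ 6 \<le> (84 * h * a + 180 * h\<^sup>2) / a ^ 6" .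
qed

text \<open>For \<open>p <= 0\<close> only \<open>- 27 q^2\<close> is negative in the numerator, so
  the slope is at least \<open>- 27 / c ^ 4\<close>. This serves points whose form value drops below
  the hexagonal one.\<close>

lemma env3_left_neg:
  assumes "0 \<le> h" "0 < c" "c \<le> q" "q \<le> a"
  shows "env3 (- h) q \<le> env3 (- h) a + 27 / c ^ 4 * (a - q)"
proof (rule le_of_deriv_ge[OF assms(4)])
  fix x assume x: "q \<le> x"
  show "(env3 (- h) has_real_derivative (180 * (- h)\<^sup>2 - 84 * (- h) * x - 27 * x\<^sup>2) / x ^ 6) (at x)"
    using assms x by (intro env3_deriv) simp
  have "- (27 / c ^ 4) \<le> - (27 / x ^ 4)"
    using assms x by (simp add: divide_left_mono power_mono)
  also have "\<dots> = (- 27 * x\<^sup>2) / x ^ 6"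
    using assms x by (simp add: field_simps power_numeral_reduce)
  also have "\<dots> \<le> (180 * (- h)\<^sup>2 - 84 * (- h) * x - 27 * x\<^sup>2) / x ^ 6"
    using assms x by (intro divide_right_mono) auto
  finally show "- (27 / c ^ 4) \<le> (180 * (- h)\<^sup>2 - 84 * (- h) * x - 27 * x\<^sup>2) / x ^ 6" .
qed

section \<open>The quadratic form around the hexagonal lattice, and upper bounds for single
  points\<close>

lemma quad_neg:
  fixes u v j k :: real
  shows "(1 + u) * j\<^sup>2 + (- k)\<^sup>2 + (1 - v) * j * (- k) = (j\<^sup>2 + k\<^sup>2 - j * k) + (j\<^sup>2 * u + j * k * v)"
  by (simp add: algebra_simps)

lemma quad_pos:
  fixes u v j k :: real
  shows "(1 + u) * j\<^sup>2 + k\<^sup>2 + (1 - v) * j * k = (j\<^sup>2 + k\<^sup>2 + j * k) + (j\<^sup>2 * u - j * k * v)"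
  by (simp add: algebra_simps)

lemma quad0_ge:
  fixes j k :: real
  shows "j\<^sup>2 + k\<^sup>2 - j * k \<ge> 3 / 4 * k\<^sup>2" "j\<^sup>2 + k\<^sup>2 - j * k \<ge> 3 / 4 * j\<^sup>2" "j\<^sup>2 + k\<^sup>2 - j * k \<ge> j * k"
proof -
  have "(j - k / 2)\<^sup>2 \<ge> 0" "(k - j / 2)\<^sup>2 \<ge> 0" "(j - k)\<^sup>2 \<ge> 0" by simp_all
  then show "j\<^sup>2 + k\<^sup>2 - j * k \<ge> 3 / 4 * k\<^sup>2" "j\<^sup>2 + k\<^sup>2 - j * k \<ge> 3 / 4 * j\<^sup>2" "j\<^sup>2 + k\<^sup>2 - j * k \<ge> j * k"
    by (simp_all add: power2_eq_square algebra_simps)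
qed

text \<open>The squared height is smallest at the hexagonal point; this justifies freezing it at
  \<open>3/4\<close> in \<open>env3\<close>.\<close>

lemma height_ge:
  fixes u v :: real
  assumes "0 \<le> u" "0 \<le> v" "v \<le> 1"
  shows "3 / 4 \<le> (1 + u) - (1 - v)\<^sup>2 / 4"
proof -
  have "(1 - v)\<^sup>2 \<le> 1" using assms by (simp add: power_le_one)
  then show ?thesis using assms by simp
qed

lemma curv3_neg_env:
  assumes uv: "0 \<le> u" "0 \<le> v" "v \<le> 1" and jk: "0 < j" "0 < k"
  shows "curv 3 (1 + u) (1 - v) j (- k) \<le> env3 (j * k) ((j\<^sup>2 + k\<^sup>2 - j * k) + (j\<^sup>2 * u + j * k * v))"
proof -
  let ?q = "(j\<^sup>2 + k\<^sup>2 - j * k) + (j\<^sup>2 * u + j * k * v)"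
  have q0: "j\<^sup>2 + k\<^sup>2 - j * k > 0"
    using quad0_ge(3)[of j k] jk mult_pos_pos[OF jk] by linarith
  then have q: "?q > 0" using uv jk by (intro add_pos_nonneg) auto
  have "curv 3 (1 + u) (1 - v) j (- k) =
      9 / ?q ^ 3 + 21 * (1 - v) * (j * k) / ?q ^ 4
        - 48 * (j * k)\<^sup>2 * ((1 + u) - (1 - v)\<^sup>2 / 4) / ?q ^ 5"
    by (subst curv_3[OF quad_neg[symmetric]]) (use q in auto)
  also have "\<dots> \<le> 9 / ?q ^ 3 + 21 * (j * k) / ?q ^ 4 - 36 * (j * k)\<^sup>2 / ?q ^ 5"
  proof (intro diff_mono add_mono divide_right_mono)
    show "21 * (1 - v) * (j * k) \<le> 21 * (j * k)"
      using uv jk mult_nonneg_nonneg[of v "j * k"] by (simp add: algebra_simps)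
    have "48 * (j * k)\<^sup>2 * (3 / 4) \<le> 48 * (j * k)\<^sup>2 * ((1 + u) - (1 - v)\<^sup>2 / 4)"
      using height_ge[OF uv] by (intro mult_left_mono) auto
    then show "36 * (j * k)\<^sup>2 \<le> 48 * (j * k)\<^sup>2 * ((1 + u) - (1 - v)\<^sup>2 / 4)" by simp
  qed (use q in auto)
  finally show ?thesis by (simp add: env3_def)
qed

text \<open>For opposite signs both \<open>u\<close> and \<open>v\<close> increase the form, so only
  the growth of \<open>env3\<close> to the right of \<open>a\<close> matters.\<close>

lemma curv3_neg_le:
  assumes uv: "0 \<le> u" "0 \<le> v" "v \<le> 1" and jk: "0 < j" "0 < k"
    and a: "a = j\<^sup>2 + k\<^sup>2 - j * k"
  shows "curv 3 (1 + u) (1 - v) j (- k) \<le> env3 (j * k) a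
    + max 0 (180 * (j * k)\<^sup>2 - 84 * (j * k) * a - 27 * a\<^sup>2) / a ^ 6 * (j\<^sup>2 * u + j * k * v)"
proof -
  have q0: "a > 0"
    unfolding a using quad0_ge(3)[of j k] jk mult_pos_pos[OF jk] by linarith
  have "a \<le> a + (j\<^sup>2 * u + j * k * v)" using uv jk by simp
  from env3_right[OF _ q0 this, of "j * k"] curv3_neg_env[OF uv jk] jk
  show ?thesis unfolding a by simp
qed

text \<open>For equal signs, freezing \<open>tau\<close> at \<open>1\<close> errs in the wrong
  direction; the term in \<open>v\<close> of the first bound pays for it. The second, cruder bound
  is for the tail of the sum.\<close>

lemma curv3_pos_env:
  assumes uv: "0 \<le> u" "0 \<le> v" "v \<le> 1" and jk: "0 < j" "0 < k"
    and q: "q = (j\<^sup>2 + k\<^sup>2 + j * k) + (j\<^sup>2 * u - j * k * v)"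
  shows "curv 3 (1 + u) (1 - v) j k \<le> env3 (- (j * k)) q + 21 * (j * k) * v / (j\<^sup>2 + k\<^sup>2) ^ 4"
    and "curv 3 (1 + u) (1 - v) j k \<le> 9 / (j\<^sup>2 + k\<^sup>2) ^ 3"
    and "j\<^sup>2 + k\<^sup>2 \<le> q"
proof -
  have c0: "0 < j\<^sup>2 + k\<^sup>2" using jk by (simp add: pos_add_strict)
  have "j * k * v \<le> j * k" using uv jk by (simp add: mult_left_le)
  moreover have "0 \<le> j\<^sup>2 * u" using uv by simp
  ultimately show qm: "j\<^sup>2 + k\<^sup>2 \<le> q" unfolding q by linarith
  with c0 have q0: "q > 0" by linarith
  have e: "curv 3 (1 + u) (1 - v) j k =
      9 / q ^ 3 - 21 * (1 - v) * (j * k) / q ^ 4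
        - 48 * (j * k)\<^sup>2 * ((1 + u) - (1 - v)\<^sup>2 / 4) / q ^ 5"
    by (rule curv_3) (use q0 in \<open>auto simp: q quad_pos\<close>)
  have h: "36 * (j * k)\<^sup>2 / q ^ 5 \<le> 48 * (j * k)\<^sup>2 * ((1 + u) - (1 - v)\<^sup>2 / 4) / q ^ 5"
  proof (intro divide_right_mono)
    have "48 * (j * k)\<^sup>2 * (3 / 4) \<le> 48 * (j * k)\<^sup>2 * ((1 + u) - (1 - v)\<^sup>2 / 4)"
      using height_ge[OF uv] by (intro mult_left_mono) auto
    then show "36 * (j * k)\<^sup>2 \<le> 48 * (j * k)\<^sup>2 * ((1 + u) - (1 - v)\<^sup>2 / 4)" by simp
  qed (use q0 in auto)
  have "21 * (j * k) * v / q ^ 4 \<le> 21 * (j * k) * v / (j\<^sup>2 + k\<^sup>2) ^ 4"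
    using uv jk c0 qm by (intro divide_left_mono power_mono) auto
  moreover have "21 * (1 - v) * (j * k) / q ^ 4 = 21 * (j * k) / q ^ 4 - 21 * (j * k) * v / q ^ 4"
    by (simp add: diff_divide_distrib[symmetric] algebra_simps)
  ultimately show "curv 3 (1 + u) (1 - v) j k \<le> env3 (- (j * k)) q + 21 * (j * k) * v / (j\<^sup>2 + k\<^sup>2) ^ 4"
    using h unfolding e env3_def by simp
  have "0 \<le> 36 * (j * k)\<^sup>2 / q ^ 5" using q0 by simp
  moreover have "0 \<le> 21 * (1 - v) * (j * k) / q ^ 4" using q0 uv jk by simp
  moreover have "9 / q ^ 3 \<le> 9 / (j\<^sup>2 + k\<^sup>2) ^ 3"
    using c0 qm by (intro divide_left_mono power_mono) auto
  ultimately show "curv 3 (1 + u) (1 - v) j k \<le> 9 / (j\<^sup>2 + k\<^sup>2) ^ 3"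
    using h unfolding e by linarith
qed

text \<open>Here \<open>u\<close> raises and \<open>v\<close> lowers the form, so \<open>q\<close>
  can lie on either side of \<open>a\<close>. The coefficient \<open>48\<close> is \<open>27\<close>
  for moving left plus \<open>21\<close> for freezing \<open>tau\<close>.\<close>

lemma curv3_pos_le:
  assumes uv: "0 \<le> u" "0 \<le> v" "v \<le> 1" and jk: "0 < j" "0 < k"
    and a: "a = j\<^sup>2 + k\<^sup>2 + j * k"
  shows "curv 3 (1 + u) (1 - v) j k \<le> env3 (- (j * k)) a
    + (84 * (j * k) * a + 180 * (j * k)\<^sup>2) / a ^ 6 * (j\<^sup>2 * u) + 48 * (j * k) / (j\<^sup>2 + k\<^sup>2) ^ 4 * v"
proof -
  define q where "q = (j\<^sup>2 + k\<^sup>2 + j * k) + (j\<^sup>2 * u - j * k * v)"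
  have c0: "0 < j\<^sup>2 + k\<^sup>2" using jk by (simp add: pos_add_strict)
  have h0: "0 < j * k" using jk by simp
  have a0: "0 < a" using c0 h0 unfolding a by linarith
  note E = curv3_pos_env[OF uv jk q_def]
  have n1: "0 \<le> (84 * (j * k) * a + 180 * (j * k)\<^sup>2) / a ^ 6"
    using h0 a0 by simp
  have n2: "0 \<le> 27 / (j\<^sup>2 + k\<^sup>2) ^ 4" by simp
  have s1: "0 \<le> j\<^sup>2 * u" "0 \<le> j * k * v" using uv jk by simp_all
  have "env3 (- (j * k)) q \<le> env3 (- (j * k)) a
    + (84 * (j * k) * a + 180 * (j * k)\<^sup>2) / a ^ 6 * (j\<^sup>2 * u) + 27 / (j\<^sup>2 + k\<^sup>2) ^ 4 * (j * k * v)"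
  proof (cases "a \<le> q")
    case True
    have "env3 (- (j * k)) q \<le> env3 (- (j * k)) a
      + (84 * (j * k) * a + 180 * (j * k)\<^sup>2) / a ^ 6 * (q - a)"
      by (rule env3_right_neg) (use h0 a0 True in auto)
    also have "\<dots> \<le> env3 (- (j * k)) a
      + (84 * (j * k) * a + 180 * (j * k)\<^sup>2) / a ^ 6 * (j\<^sup>2 * u)"
      by (intro add_left_mono mult_left_mono n1) (use s1 in \<open>auto simp: q_def a\<close>)
    finally show ?thesis using mult_nonneg_nonneg[OF n2 s1(2)] by linarith
  next
    case False
    have "env3 (- (j * k)) q \<le> env3 (- (j * k)) a + 27 / (j\<^sup>2 + k\<^sup>2) ^ 4 * (a - q)"
      by (rule env3_left_neg) (use h0 c0 False E(3) in auto)
    also have "\<dots> \<le> env3 (- (j * k)) a + 27 / (j\<^sup>2 + k\<^sup>2) ^ 4 * (j * k * v)"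
      by (intro add_left_mono mult_left_mono n2) (use s1 in \<open>auto simp: q_def a\<close>)
    finally show ?thesis using mult_nonneg_nonneg[OF n1 s1(1)] by linarith
  qed
  moreover have "27 / (j\<^sup>2 + k\<^sup>2) ^ 4 * (j * k * v) + 21 * (j * k) * v / (j\<^sup>2 + k\<^sup>2) ^ 4
     = 48 * (j * k) / (j\<^sup>2 + k\<^sup>2) ^ 4 * v"
    by (simp add: add_divide_distrib[symmetric] algebra_simps)
  ultimately show ?thesis using E(1) by linarith
qed

text \<open>With \<open>t = p / q\<close>, the quadratic \<open>9 + 21 t - 36 t^2\<close> is largest
  at \<open>t = 7/24\<close>, where it equals \<open>193/16\<close>.\<close>

lemma env3_le:
  assumes "q > 0"
  shows "env3 p q \<le> (193 / 16) / q ^ 3"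
proof -
  have "env3 p q = (193 / 16) / q ^ 3 - 36 * (p / q - 7 / 24)\<^sup>2 / q ^ 3"
    using assms by (simp add: env3_def field_simps power_numeral_reduce)
  then show ?thesis using assms by simp
qed

section \<open>Lattice points off the axes and diagonals\<close>

definition offdiag :: "nat \<Rightarrow> (nat \<times> nat) set" where
  "offdiag K = {(j, k). 1 \<le> j \<and> j \<le> K \<and> 1 \<le> k \<and> k \<le> K \<and> j \<noteq> k}"

lemma finite_offdiag [simp]: "finite (offdiag K)"
  by (rule finite_subset[of _ "{1..K} \<times> {1..K}"]) (auto simp: offdiag_def)

lemma offdiag_0 [simp]: "offdiag 0 = {}" and offdiag_1 [simp]: "offdiag (Suc 0) = {}"
  by (auto simp: offdiag_def)

lemma sum_offdiag_Suc:
  fixes a :: "nat \<times> nat \<Rightarrow> real"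
  shows "sum a (offdiag (Suc K)) = sum a (offdiag K) + (\<Sum>j = 1..K. a (j, Suc K) + a (Suc K, j))"
proof -
  have eq: "offdiag (Suc K) = offdiag K \<union> ((\<lambda>j. (j, Suc K)) ` {1..K} \<union> (\<lambda>j. (Suc K, j)) ` {1..K})"
    by (auto simp: offdiag_def)
  have d: "offdiag K \<inter> ((\<lambda>j. (j, Suc K)) ` {1..K} \<union> (\<lambda>j. (Suc K, j)) ` {1..K}) = {}"
    "(\<lambda>j. (j, Suc K)) ` {1..K} \<inter> (\<lambda>j. (Suc K, j)) ` {1..K} = {}"
    by (auto simp: offdiag_def)
  have "sum a (offdiag (Suc K)) = sum a (offdiag K)
      + (sum a ((\<lambda>j. (j, Suc K)) ` {1..K}) + sum a ((\<lambda>j. (Suc K, j)) ` {1..K}))"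
    unfolding eq
    by (subst sum.union_disjoint[OF _ _ d(1)]; (subst sum.union_disjoint[OF _ _ d(2)])?)
      (simp_all del: One_nat_def)
  also have "\<dots> = sum a (offdiag K) + (\<Sum>j = 1..K. a (j, Suc K) + a (Suc K, j))"
    by (simp add: sum.reindex inj_on_def sum.distrib)
  finally show ?thesis .
qed

text \<open>The shell of points with maximum \<open>x\<close> has \<open>2 (x - 1)\<close> elements,
  hence contributes less than \<open>2 c / x ^ 5\<close>, and this is dominated by a telescoping
  difference.\<close>

lemma sum_offdiag_le:
  fixes a :: "nat \<times> nat \<Rightarrow> real"
  assumes K0: "1 \<le> K0" "K0 \<le> K" and c: "0 \<le> c"
    and le: "\<And>j k. \<lbrakk>1 \<le> j; 1 \<le> k; j \<noteq> k; K0 < max j k\<rbrakk> \<Longrightarrow> a (j, k) \<le> c / real (max j k) ^ 6"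
  shows "sum a (offdiag K) \<le> sum a (offdiag K0) + c / (2 * (real K0)\<^sup>2 * (real K0 + 1)\<^sup>2)"
proof -
  define B where "B k = c / (2 * (real k)\<^sup>2 * (real k + 1)\<^sup>2)" for k :: nat
  have "sum a (offdiag K) \<le> sum a (offdiag K0) + (B K0 - B K)"
    using K0(2)
  proof (induction K rule: dec_induct)
    case (step K)
    define x where "x = real K + 1"
    have x: "x > 1" using step.hyps K0 by (simp add: x_def)
    have "(\<Sum>j = 1..K. a (j, Suc K) + a (Suc K, j)) \<le> (\<Sum>j = 1..K. c / x ^ 6 + c / x ^ 6)"
    proof (intro sum_mono add_mono)
      fix j assume j: "j \<in> {1..K}"
      then have m: "max j (Suc K) = Suc K" "max (Suc K) j = Suc K" by auto
      show "a (j, Suc K) \<le> c / x ^ 6" "a (Suc K, j) \<le> c / x ^ 6"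
        using le[of j "Suc K"] le[of "Suc K" j] j step.hyps unfolding m
        by (auto simp: x_def add.commute)
    qed
    also have "\<dots> = 2 * (x - 1) * (c / x ^ 6)" by (simp add: x_def)
    also have "\<dots> \<le> 2 * x * (c / x ^ 6)"
      using c x by (intro mult_right_mono) auto
    also have "\<dots> = 2 * c / (x * (x\<^sup>2)\<^sup>2)"
      using x by (simp add: field_simps power_numeral_reduce)
    \<comment> \<open>Lowering \<open>x^2\<close> to \<open>x^2 - 1\<close> turns the bound into an
      exact difference of consecutive values of \<open>B\<close>.\<close>
    also have "\<dots> \<le> 2 * c / (x * (x\<^sup>2 - 1)\<^sup>2)"
    proof (intro divide_left_mono mult_left_mono power_mono)
      have "x\<^sup>2 > 1" using x by simp
      then have "(x\<^sup>2 - 1)\<^sup>2 > 0" by simp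
      with \<open>x\<^sup>2 > 1\<close> show "0 < x * (x\<^sup>2)\<^sup>2 * (x * (x\<^sup>2 - 1)\<^sup>2)" "0 \<le> x\<^sup>2 - 1"
        using x by (simp_all del: power2_less_0 zero_less_power2)
    qed (use c x in auto)
    also have "\<dots> = c / (2 * (x - 1)\<^sup>2 * x\<^sup>2) - c / (2 * x\<^sup>2 * (x + 1)\<^sup>2)"
    proof -
      have f: "x\<^sup>2 - 1 = (x - 1) * (x + 1)" by (simp add: power2_eq_square algebra_simps)
      have "x \<noteq> 0" "x - 1 \<noteq> 0" "x + 1 \<noteq> 0" using x by auto
      then show ?thesis unfolding f by (simp add: divide_simps) algebra
    qed
    also have "\<dots> = B K - B (Suc K)" by (simp add: B_def x_def add_ac)
    finally show ?case using step.IH unfolding sum_offdiag_Suc by linarith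
  qed simp
  moreover have "0 \<le> B K" using c by (simp add: B_def)
  ultimately show ?thesis by (simp add: B_def)
qed

text \<open>Bounds for the two points \<open>(j, - k)\<close> and \<open>(j, k)\<close> together: the value at the hexagonal point, and
  slopes in \<open>u = \<rho> - 1\<close> and \<open>v = 1 - \<tau>\<close>.\<close>

definition off3 :: "nat \<times> nat \<Rightarrow> real" where
  "off3 = (\<lambda>(j, k). let p = real j * real k; a = (real j)\<^sup>2 + (real k)\<^sup>2 in
     env3 p (a - p) + env3 (- p) (a + p))"

definition off3u :: "nat \<times> nat \<Rightarrow> real" where
  "off3u = (\<lambda>(j, k). let p = real j * real k; a = (real j)\<^sup>2 + (real k)\<^sup>2 in
     (max 0 (180 * p\<^sup>2 - 84 * p * (a - p) - 27 * (a - p)\<^sup>2) / (a - p) ^ 6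
       + (84 * p * (a + p) + 180 * p\<^sup>2) / (a + p) ^ 6) * (real j)\<^sup>2)"

definition off3v :: "nat \<times> nat \<Rightarrow> real" where
  "off3v = (\<lambda>(j, k). let p = real j * real k; a = (real j)\<^sup>2 + (real k)\<^sup>2 in
     max 0 (180 * p\<^sup>2 - 84 * p * (a - p) - 27 * (a - p)\<^sup>2) / (a - p) ^ 6 * p + 48 * p / a ^ 4)"

lemma sum_offdiag_list:
  fixes a :: "nat \<times> nat \<Rightarrow> real"
  shows "sum a (offdiag K) = (\<Sum>k\<leftarrow>[1..<Suc K]. \<Sum>j\<leftarrow>[1..<k]. a (j, k) + a (k, j))"
proof (induction K)
  case (Suc K)
  have "(\<Sum>j = 1..K. a (j, Suc K) + a (Suc K, j)) = (\<Sum>j\<leftarrow>[1..<Suc K]. a (j, Suc K) + a (Suc K, j))"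
    by (simp add: interv_sum_list_conv_sum_set_nat atLeastLessThanSuc_atLeastAtMost del: upt_Suc)
  then show ?case using Suc by (simp add: sum_offdiag_Suc)
qed simp

lemma upt_table:
  "[Suc 0..<Suc 0] = []"
  "[Suc 0..<2] = [Suc 0]"
  "[Suc 0..<3] = [Suc 0, 2]"
  "[Suc 0..<4] = [Suc 0, 2, 3]"
  "[Suc 0..<5] = [Suc 0, 2, 3, 4]"
  "[Suc 0..<6] = [Suc 0, 2, 3, 4, 5]"
  "[Suc 0..<7] = [Suc 0, 2, 3, 4, 5, 6]"
  "[Suc 0..<8] = [Suc 0, 2, 3, 4, 5, 6, 7]"
  "[Suc 0..<9] = [Suc 0, 2, 3, 4, 5, 6, 7, 8]"
  "[Suc 0..<10] = [Suc 0, 2, 3, 4, 5, 6, 7, 8, 9]"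
  "[Suc 0..<11] = [Suc 0, 2, 3, 4, 5, 6, 7, 8, 9, 10]"
  by (simp_all add: upt_rec)

text \<open>The margin in the final inequality is so small that the pairs up to \<open>10\<close> have to be summed explicitly.\<close>

lemma sum_off3_10: "sum off3 (offdiag 10) \<le> 0.6186"
  unfolding sum_offdiag_list
  by (simp add: off3_def env3_def Let_def upt_table)

lemma sum_off3u_10: "sum off3u (offdiag 10) \<le> 0.36"
  unfolding sum_offdiag_list
  by (simp add: off3u_def Let_def upt_table)

lemma sum_off3v_10: "sum off3v (offdiag 10) \<le> 0.62"
  unfolding sum_offdiag_list
  by (simp add: off3v_def Let_def upt_table)

abbreviation offcurv :: "nat \<Rightarrow> real \<Rightarrow> real \<Rightarrow> nat \<times> nat \<Rightarrow> real" where
  "offcurv s u v \<equiv> (\<lambda>(j, k). curv s (1 + u) (1 - v) (real j) (- real k) + curv s (1 + u) (1 - v) (real j) (real k))"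

lemma max_sq_le:
  fixes j k :: nat
  shows "3 / 4 * (real (max j k))\<^sup>2 \<le> (real j)\<^sup>2 + (real k)\<^sup>2 - real j * real k"
    and "(real (max j k))\<^sup>2 \<le> (real j)\<^sup>2 + (real k)\<^sup>2"
  using quad0_ge[where j = "real j" and k = "real k"] by (auto simp: max_def)

lemma inverse_cube_le:
  fixes M q :: real
  assumes "0 < M" "c * M\<^sup>2 \<le> q" "0 < c" "0 \<le> e"
  shows "e / q ^ 3 \<le> (e / c ^ 3) / M ^ 6"
proof -
  have "e / q ^ 3 \<le> e / (c * M\<^sup>2) ^ 3"
  proof (intro divide_left_mono power_mono)
    have "0 < c * M\<^sup>2" using assms by simp
    with assms show "0 < q ^ 3 * (c * M\<^sup>2) ^ 3" by (meson less_le_trans mult_pos_pos zero_less_power)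
  qed (use assms in auto)
  also have "\<dots> = (e / c ^ 3) / M ^ 6" by (simp add: power_mult_distrib power_mult[symmetric])
  finally show ?thesis .
qed

text \<open>The constant is the explicit sum \<open>0.6186\<close> plus the tail
  \<open>37.6 / (2 * 10^2 * 11^2)\<close>, where \<open>37.6\<close> exceeds
  \<open>193/16 / (3/4)^3 + 9\<close>, the crude bounds for the two signs.\<close>

lemma offcurv3_le:
  assumes uv: "0 \<le> u" "0 \<le> v" "v \<le> 1" and K: "10 \<le> K"
  shows "sum (offcurv 3 u v) (offdiag K) \<le> 0.62016 + 0.36 * u + 0.62 * v"
proof -
  have "sum (offcurv 3 u v) (offdiag K)
      \<le> sum (offcurv 3 u v) (offdiag 10) + 37.6 / (2 * (real 10)\<^sup>2 * (real 10 + 1)\<^sup>2)"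
  proof (rule sum_offdiag_le)
    fix j k :: nat assume jk: "1 \<le> j" "1 \<le> k" "j \<noteq> k" "10 < max j k"
    define M where "M = real (max j k)"
    have M: "0 < M" using jk by (auto simp: M_def)
    have p: "0 < real j" "0 < real k" using jk by auto
    let ?q = "((real j)\<^sup>2 + (real k)\<^sup>2 - real j * real k) + ((real j)\<^sup>2 * u + real j * real k * v)"
    have "3 / 4 * M\<^sup>2 \<le> ?q"
      using max_sq_le(1)[of j k] uv unfolding M_def by (smt (verit) mult_nonneg_nonneg of_nat_0_le_iff zero_le_power2)
    moreover have "0 < 3 / 4 * M\<^sup>2" using M by simp
    ultimately have q: "3 / 4 * M\<^sup>2 \<le> ?q" "0 < ?q" by linarith+
    have "curv 3 (1 + u) (1 - v) (real j) (- real k) \<le> (193 / 16) / ?q ^ 3"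
      using curv3_neg_env[OF uv p] env3_le[OF q(2)] by (rule order_trans)
    also have "\<dots> \<le> (193 / 16 / (3 / 4) ^ 3) / M ^ 6"
      by (rule inverse_cube_le) (use M q in auto)
    finally have 1: "curv 3 (1 + u) (1 - v) (real j) (- real k) \<le> (193 / 16 / (3 / 4) ^ 3) / M ^ 6" .
    have "curv 3 (1 + u) (1 - v) (real j) (real k) \<le> 9 / ((real j)\<^sup>2 + (real k)\<^sup>2) ^ 3"
      by (rule curv3_pos_env(2)[OF uv p refl])
    also have "\<dots> \<le> (9 / 1 ^ 3) / M ^ 6"
      by (rule inverse_cube_le) (use M max_sq_le(2)[of j k] in \<open>auto simp: M_def\<close>)
    finally have "offcurv 3 u v (j, k) \<le> (193 / 16 / (3 / 4) ^ 3 + 9) / M ^ 6"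
      using 1 by (simp add: add_divide_distrib)
    also have "\<dots> \<le> 37.6 / M ^ 6"
      using M by (intro divide_right_mono) (auto simp: power_numeral_reduce)
    finally show "offcurv 3 u v (j, k) \<le> 37.6 / real (max j k) ^ 6" by (simp add: M_def)
  qed (use K in auto)
  moreover have "sum (offcurv 3 u v) (offdiag 10) \<le> sum (\<lambda>x. off3 x + off3u x * u + off3v x * v) (offdiag 10)"
  proof (rule sum_mono)
    fix x assume "x \<in> offdiag 10"
    then obtain j k where x: "x = (j, k)" and "1 \<le> j" "1 \<le> k" by (auto simp: offdiag_def)
    then have p: "0 < real j" "0 < real k" by auto
    define h where "h = real j * real k"
    define a where "a = (real j)\<^sup>2 + (real k)\<^sup>2"
    define X where "X = max 0 (180 * h\<^sup>2 - 84 * h * (a - h) - 27 * (a - h)\<^sup>2) / (a - h) ^ 6"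
    define Y where "Y = (84 * h * (a + h) + 180 * h\<^sup>2) / (a + h) ^ 6"
    have "curv 3 (1 + u) (1 - v) (real j) (- real k) \<le> env3 h (a - h) + X * ((real j)\<^sup>2 * u + h * v)"
      unfolding X_def h_def a_def by (rule curv3_neg_le[OF uv p refl])
    moreover have "curv 3 (1 + u) (1 - v) (real j) (real k)
        \<le> env3 (- h) (a + h) + Y * ((real j)\<^sup>2 * u) + 48 * h / a ^ 4 * v"
      unfolding Y_def h_def a_def by (rule curv3_pos_le[OF uv p refl])
    moreover have "off3 x = env3 h (a - h) + env3 (- h) (a + h)"
      "off3u x = (X + Y) * (real j)\<^sup>2" "off3v x = X * h + 48 * h / a ^ 4"
      by (simp_all add: x off3_def off3u_def off3v_def Let_def h_def a_def X_def Y_def)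
    ultimately show "offcurv 3 u v x \<le> off3 x + off3u x * u + off3v x * v"
      by (simp add: x algebra_simps)
  qed
  moreover have "\<dots> = sum off3 (offdiag 10) + sum off3u (offdiag 10) * u + sum off3v (offdiag 10) * v"
    by (simp add: sum.distrib sum_distrib_right)
  moreover have "sum off3u (offdiag 10) * u \<le> 0.36 * u" "sum off3v (offdiag 10) * v \<le> 0.62 * v"
    using sum_off3u_10 sum_off3v_10 uv by (intro mult_right_mono; simp)+
  ultimately show ?thesis using sum_off3_10 by simp
qed

section \<open>Lower bounds off the axes and diagonals, for both exponents\<close>

lemma curv_neg_ge:
  assumes uv: "0 \<le> u" "0 \<le> v" "v \<le> 1" and jk: "0 < j" "0 < k"
    and q: "q = (j\<^sup>2 + k\<^sup>2 - j * k) + (j\<^sup>2 * u + j * k * v)"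
  shows "- (2 * real s) / q ^ s \<le> curv s (1 + u) (1 - v) j (- k)"
proof -
  have h0: "0 < j * k" using jk by simp
  have s1: "0 \<le> j\<^sup>2 * u" "0 \<le> j * k * v" using uv jk by simp_all
  have q0: "0 < q" "j * k \<le> q" using quad0_ge(3)[of j k] h0 s1 unfolding q by linarith+
  \<comment> \<open>The square term of \<open>curv\<close> is discarded, and \<open>j k <= q\<close>
    gives the factor \<open>2\<close>; for equal signs the factor is \<open>1\<close>.\<close>
  have m: "(1 + u) * j\<^sup>2 + (- k)\<^sup>2 \<le> 2 * q"
  proof -
    have "(1 + u) * j\<^sup>2 + (- k)\<^sup>2 = q + (1 - v) * (j * k)" by (simp add: q algebra_simps)
    also have "(1 - v) * (j * k) \<le> j * k" using s1 by (simp add: algebra_simps)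
    finally show ?thesis using q0 by linarith
  qed
  have "real s * ((1 + u) * j\<^sup>2 + (- k)\<^sup>2) / q ^ (s + 1) \<le> real s * (2 * q) / q ^ (s + 1)"
    using m q0 by (intro divide_right_mono mult_left_mono) auto
  also have "\<dots> = 2 * real s / q ^ s" using q0 by simp
  finally have "real s * ((1 + u) * j\<^sup>2 + (- k)\<^sup>2) / q ^ (s + 1) \<le> 2 * real s / q ^ s" .
  moreover have "0 \<le> real s * (real s + 1) * ((1 + u) * j\<^sup>2 - (- k)\<^sup>2)\<^sup>2 / q ^ (s + 2)"
    using q0 by simp
  ultimately show ?thesis
    unfolding curv_def quad_neg q[symmetric] by simp
qed

lemma curv_pos_ge:
  assumes uv: "0 \<le> u" "0 \<le> v" "v \<le> 1" and jk: "0 < j" "0 < k"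
    and q: "q = (j\<^sup>2 + k\<^sup>2 + j * k) + (j\<^sup>2 * u - j * k * v)"
  shows "- real s / q ^ s \<le> curv s (1 + u) (1 - v) j k" and "j\<^sup>2 + k\<^sup>2 + j\<^sup>2 * u \<le> q"
proof -
  have c0: "0 < j\<^sup>2 + k\<^sup>2" using jk by (simp add: pos_add_strict)
  have "j * k * v \<le> j * k" using uv jk by (simp add: mult_left_le)
  then show qm: "j\<^sup>2 + k\<^sup>2 + j\<^sup>2 * u \<le> q" unfolding q by linarith
  moreover have "0 \<le> j\<^sup>2 * u" using uv by simp
  ultimately have q0: "q > 0" using c0 by linarith
  have "real s * ((1 + u) * j\<^sup>2 + k\<^sup>2) / q ^ (s + 1) \<le> real s * q / q ^ (s + 1)"
    using qm q0 by (intro divide_right_mono mult_left_mono) (auto simp: algebra_simps)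
  also have "\<dots> = real s / q ^ s" using q0 by simp
  finally have "real s * ((1 + u) * j\<^sup>2 + k\<^sup>2) / q ^ (s + 1) \<le> real s / q ^ s" .
  moreover have "0 \<le> real s * (real s + 1) * ((1 + u) * j\<^sup>2 - k\<^sup>2)\<^sup>2 / q ^ (s + 2)"
    using q0 by simp
  ultimately show "- real s / q ^ s \<le> curv s (1 + u) (1 - v) j k"
    unfolding curv_def quad_pos q[symmetric] by simp
qed

text \<open>The whole sum is treated as a tail, starting from the empty set
  \<open>offdiag 1\<close>: \<open>17.3 / 8 < 11/5\<close>. The loss is matched by the bound for
  \<open>main3\<close> in \<open>main_pos\<close>.\<close>

lemma offcurv3_ge:
  assumes uv: "0 \<le> u" "0 \<le> v" "v \<le> 1" and K: "1 \<le> K"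
  shows "- 11 / 5 \<le> sum (offcurv 3 u v) (offdiag K)"
proof -
  have "sum (\<lambda>x. - offcurv 3 u v x) (offdiag K)
      \<le> sum (\<lambda>x. - offcurv 3 u v x) (offdiag 1) + 17.3 / (2 * (real 1)\<^sup>2 * (real 1 + 1)\<^sup>2)"
  proof (rule sum_offdiag_le)
    fix j k :: nat assume jk: "1 \<le> j" "1 \<le> k" "j \<noteq> k" "1 < max j k"
    define M where "M = real (max j k)"
    have M: "0 < M" using jk by (auto simp: M_def)
    have p: "0 < real j" "0 < real k" using jk by auto
    define q where "q = ((real j)\<^sup>2 + (real k)\<^sup>2 - real j * real k) + ((real j)\<^sup>2 * u + real j * real k * v)"
    define Q where "Q = ((real j)\<^sup>2 + (real k)\<^sup>2 + real j * real k) + ((real j)\<^sup>2 * u - real j * real k * v)"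
    have s1: "0 \<le> (real j)\<^sup>2 * u" "0 \<le> real j * real k * v" using uv by simp_all
    have "6 / q ^ 3 \<le> (6 / (3 / 4) ^ 3) / M ^ 6"
      by (rule inverse_cube_le) (use M max_sq_le(1)[of j k] s1 in \<open>auto simp: M_def q_def\<close>)
    moreover have "3 / Q ^ 3 \<le> (3 / 1 ^ 3) / M ^ 6"
      by (rule inverse_cube_le) (use M max_sq_le(2)[of j k] s1 curv_pos_ge(2)[OF uv p Q_def] in \<open>auto simp: M_def\<close>)
    ultimately have "- offcurv 3 u v (j, k) \<le> (6 / (3 / 4) ^ 3 + 3) / M ^ 6"
      using curv_neg_ge[OF uv p q_def, of 3] curv_pos_ge(1)[OF uv p Q_def, of 3]
      by (simp add: add_divide_distrib)
    also have "\<dots> \<le> 17.3 / M ^ 6"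
      using M by (intro divide_right_mono) (auto simp: power_numeral_reduce)
    finally show "- offcurv 3 u v (j, k) \<le> 17.3 / real (max j k) ^ 6" by (simp add: M_def)
  qed (use K in auto)
  then show ?thesis by (simp add: sum_negf)
qed

text \<open>Since \<open>\<rho> / (a + \<rho>) ^ 3\<close> is largest at \<open>\<rho> = a / 2\<close>, this bound is uniform in the height.\<close>

lemma cube_div_sixth_le:
  fixes a q y \<rho> :: real
  assumes "0 < a" "a + \<rho> \<le> q" "1 \<le> \<rho>" "0 \<le> y" "y\<^sup>2 \<le> \<rho>"
  shows "y ^ 3 / q ^ 6 \<le> (16 / 729) / a ^ 4"
proof -
  have q: "0 < q" using assms by linarith
  have r0: "0 \<le> \<rho>" using assms(3) by linarith
  have "\<rho> \<le> \<rho>\<^sup>2" using assms(3) by (rule self_le_power) simp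
  with assms(5) have "y\<^sup>2 \<le> \<rho>\<^sup>2" by (rule order_trans)
  then have "y \<le> \<rho>" using r0 by (rule power2_le_imp_le)
  then have "y * y\<^sup>2 \<le> \<rho> * \<rho>" using assms(5) r0 zero_le_power2 by (rule mult_mono)
  then have y3: "y ^ 3 \<le> \<rho>\<^sup>2" by (simp add: power_numeral_reduce)
  have "4 * (a + \<rho>) ^ 3 - 27 * a\<^sup>2 * \<rho> = (2 * \<rho> - a)\<^sup>2 * (\<rho> + 4 * a)" by algebra
  also have "\<dots> \<ge> 0" using assms by simp
  finally have "27 * a\<^sup>2 * \<rho> \<le> 4 * (a + \<rho>) ^ 3" by simp
  also have "\<dots> \<le> 4 * q ^ 3" using assms by (intro mult_left_mono power_mono) auto
  finally have "\<rho> / q ^ 3 \<le> 4 / (27 * a\<^sup>2)" using q assms by (simp add: field_simps)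
  then have "(\<rho> / q ^ 3)\<^sup>2 \<le> (4 / (27 * a\<^sup>2))\<^sup>2"
    using q assms by (intro power_mono) auto
  then have "\<rho>\<^sup>2 / q ^ 6 \<le> (16 / 729) / a ^ 4"
    by (simp add: power_divide power_mult_distrib power_mult[symmetric])
  moreover have "y ^ 3 / q ^ 6 \<le> \<rho>\<^sup>2 / q ^ 6" using y3 q by (intro divide_right_mono) auto
  ultimately show ?thesis by linarith
qed

text \<open>At the hexagonal point \<open>q = 3\<close> and \<open>y^2 = 3/4\<close>, and the value
  \<open>288 / 3^8 * (3/4) powr (3/2)\<close> is just above \<open>0.0285\<close>. Beyond
  \<open>u + v = 0.06\<close> the left side is below \<open>- 0.03\<close>, and the uniform bound
  \<open>- 0.0165\<close> is enough.\<close>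

lemma curv6_neg_12:
  assumes uv: "0 \<le> u" "0 \<le> v" "v \<le> 1" and y: "0 \<le> y" "y\<^sup>2 = (1 + u) - (1 - v)\<^sup>2 / 4"
    and jk: "(j = 1 \<and> k = 2) \<or> (j = 2 \<and> k = (1 :: real))"
  shows "0.0285 - (u + v) \<le> y ^ 3 * curv 6 (1 + u) (1 - v) j (- k)"
proof -
  define q where "q = (j\<^sup>2 + k\<^sup>2 - j * k) + (j\<^sup>2 * u + j * k * v)"
  have jk0: "0 < j" "0 < k" and hk: "j * k = 2" using jk by auto
  define d where "d = q - 3"
  have d: "d = u + 2 * v \<or> d = 4 * u + 2 * v" using jk by (auto simp: d_def q_def)
  then have d0: "0 \<le> d" "u + 2 * v \<le> d" "d \<le> 4 * (u + v)" using uv by auto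
  have q: "q = 3 + d" "0 < q" using d0 by (auto simp: d_def)
  have q2: "2 + (1 + u) \<le> q" using d0 uv q by linarith
  have y2: "y\<^sup>2 \<le> 1 + u" using y by simp
  have y34: "3 / 4 \<le> y\<^sup>2" using height_ge[OF uv] y by simp
  show ?thesis
  proof (cases "u + v \<le> 0.06")
    case False
    have "y ^ 3 / q ^ 6 \<le> (16 / 729) / 2 ^ 4"
      by (rule cube_div_sixth_le[OF _ q2 _ y(1) y2]) (use uv in auto)
    then have "- 12 * (y ^ 3 / q ^ 6) \<ge> - 0.0165" by simp
    moreover have "y ^ 3 * (- 12 / q ^ 6) \<le> y ^ 3 * curv 6 (1 + u) (1 - v) j (- k)"
      using curv_neg_ge[OF uv jk0 q_def, of 6] y by (intro mult_left_mono) auto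
    ultimately show ?thesis using False by simp
  next
    case True
    define w where "w = u + v"
    have w: "0 \<le> w" "w \<le> 0.06" using True uv by (auto simp: w_def)
    have e: "curv 6 (1 + u) (1 - v) j (- k) = (36 * q\<^sup>2 + 156 * (1 - v) * q - 672 * y\<^sup>2) / q ^ 8"
    proof -
      have "curv 6 (1 + u) (1 - v) j (- k) =
        36 / q ^ 6 - 78 * (1 - v) * (j * (- k)) / q ^ 7 - 168 * (j * (- k))\<^sup>2 * y\<^sup>2 / q ^ 8"
        unfolding y(2) by (rule curv_6) (simp only: q_def quad_neg, use q in simp)
      moreover have "36 / q ^ 6 = 36 * q\<^sup>2 / q ^ 8" "c / q ^ 7 = c * q / q ^ 8" for c
        using q(2) by (simp_all add: divide_simps power_numeral_reduce)
      ultimately show ?thesis using hk by (simp add: add_divide_distrib diff_divide_distrib algebra_simps)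
    qed
    have "y\<^sup>2 \<le> 3 / 4 + u + v / 2"
    proof -
      have "(1 - v)\<^sup>2 \<ge> 1 - 2 * v" by (simp add: power2_eq_square algebra_simps)
      then show ?thesis using y by simp
    qed
    moreover have "36 * q\<^sup>2 \<ge> 36 * (9 + 6 * d)" unfolding q by (simp add: power2_eq_square algebra_simps)
    \<comment> \<open>Here \<open>81/25 = 3 + 0.24\<close>, because
      \<open>d <= 4 * 0.06\<close>.\<close>
    moreover have "156 * (1 - v) * q \<ge> 156 * (3 + d - 81 / 25 * v)"
    proof -
      have "v * d \<le> v * 0.24" using uv d0 w by (intro mult_left_mono) (auto simp: w_def)
      then show ?thesis unfolding q by (simp add: algebra_simps)
    qed
    moreover have "288 - 300 * w \<le> Q + X - 672 * Z"
      if "Z \<le> 3 / 4 + u + v / 2" "36 * (9 + 6 * d) \<le> Q" "156 * (3 + d - 81 / 25 * v) \<le> X" for Q X Z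
      using that d0 uv unfolding w_def by (simp add: algebra_simps)
    ultimately have n: "36 * q\<^sup>2 + 156 * (1 - v) * q - 672 * y\<^sup>2 \<ge> 288 - 300 * w"
      by blast
    \<comment> \<open>Bernoulli's inequality for \<open>(3 / q) ^ 8\<close>, based on
      \<open>3 / q >= 1 - 4/3 w\<close>.\<close>
    have "1 + real 8 * (- (4 / 3 * w)) \<le> (1 + (- (4 / 3 * w))) ^ 8"
      by (rule Bernoulli_inequality) (use w in auto)
    moreover have "((1 + (- (4 / 3 * w))) * q) ^ 8 \<le> 3 ^ 8"
    proof (intro power_mono)
      have "(1 + (- (4 / 3 * w))) * q \<le> (1 + (- (4 / 3 * w))) * (3 + 4 * w)"
        using d0 w q by (intro mult_left_mono) (auto simp: w_def)
      also have "\<dots> \<le> 3" by (simp add: algebra_simps)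
      finally show "(1 + (- (4 / 3 * w))) * q \<le> 3" .
    qed (use w q in auto)
    then have "(1 + (- (4 / 3 * w))) ^ 8 * q ^ 8 \<le> 3 ^ 8" by (simp only: power_mult_distrib)
    then have "(1 + (- (4 / 3 * w))) ^ 8 \<le> 3 ^ 8 / q ^ 8"
      using q(2) by (simp only: pos_le_divide_eq zero_less_power)
    ultimately have "1 + real 8 * (- (4 / 3 * w)) \<le> 3 ^ 8 / q ^ 8" by (rule order_trans)
    then have i: "(1 - 32 / 3 * w) / 6561 \<le> 1 / q ^ 8" by simp
    have "(288 - 300 * w) * ((1 - 32 / 3 * w) / 6561) \<le> (36 * q\<^sup>2 + 156 * (1 - v) * q - 672 * y\<^sup>2) * (1 / q ^ 8)"
      using n i w by (intro mult_mono) auto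
    then have c: "(288 - 300 * w) * (1 - 32 / 3 * w) / 6561 \<le> curv 6 (1 + u) (1 - v) j (- k)"
      unfolding e by simp
    have "0.866 \<le> y"
    proof (rule power2_le_imp_le)
      show "0.866\<^sup>2 \<le> y\<^sup>2" using y34 by (simp add: power2_eq_square)
    qed (use y in auto)
    then have "0.866 * (3 / 4) \<le> y * y\<^sup>2" using y34 y by (intro mult_mono) auto
    then have y3: "0.6495 \<le> y ^ 3" by (simp add: power_numeral_reduce)
    define X where "X = (288 - 300 * w) * (1 - 32 / 3 * w)"
    have "288 - 3372 * w \<le> X" by (simp add: X_def algebra_simps)
    moreover have "0.6495 * (X / 6561) \<le> y ^ 3 * curv 6 (1 + u) (1 - v) j (- k)"
      unfolding X_def using y3 c w y by (intro mult_mono) auto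
    ultimately show ?thesis using w unfolding w_def[symmetric] by simp
  qed
qed

text \<open>The points with \<open>j k = 2\<close> and opposite signs give a positive contribution that cannot be neglected;
  it is estimated by \<open>curv6_neg_12\<close>.\<close>

definition off6 :: "nat \<times> nat \<Rightarrow> real" where
  "off6 = (\<lambda>(j, k). let p = real j * real k; a = (real j)\<^sup>2 + (real k)\<^sup>2 in
     (if p = 2 then 0 else (64 / 243) / (a - p - 1) ^ 4) + (32 / 243) / (a - 1) ^ 4)"

lemma sum_off6_3: "sum off6 (offdiag 3) \<le> 0.0019"
  unfolding sum_offdiag_list
  by (simp add: off6_def Let_def upt_table)

lemma offcurv6_pair:
  assumes uv: "0 \<le> u" "0 \<le> v" "v \<le> 1" and y: "0 \<le> y" "y\<^sup>2 = (1 + u) - (1 - v)\<^sup>2 / 4"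
    and jk: "1 \<le> j" "1 \<le> k" "j \<noteq> k"
  shows "- (y ^ 3 * offcurv 6 u v (j, k)) \<le> off6 (j, k) + (if j * k = 2 then u + v - 0.0285 else 0)"
proof -
  have p: "0 < real j" "0 < real k" "1 \<le> real j" using jk by auto
  define q where "q = ((real j)\<^sup>2 + (real k)\<^sup>2 - real j * real k) + ((real j)\<^sup>2 * u + real j * real k * v)"
  define Q where "Q = ((real j)\<^sup>2 + (real k)\<^sup>2 + real j * real k) + ((real j)\<^sup>2 * u - real j * real k * v)"
  have s1: "0 \<le> real j * real k * v" using uv by simp
  have s2: "u \<le> (real j)\<^sup>2 * u" using uv p mult_right_mono[of 1 "(real j)\<^sup>2" u] by simp
  have y2: "y\<^sup>2 \<le> 1 + u" using y by simp
  have y3: "0 \<le> y ^ 3" using y by simp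
  have jk3: "1 * 2 \<le> j * k"
  proof -
    have "2 \<le> j \<or> 2 \<le> k" using jk by linarith
    then show ?thesis using jk mult_le_mono[of 1 j 2 k] mult_le_mono[of 2 j 1 k] by auto
  qed
  then have "real 2 \<le> real (j * k)" by (simp only: of_nat_le_iff mult_1)
  then have jk2: "2 \<le> real j * real k" by simp
  have "- (y ^ 3 * curv 6 (1 + u) (1 - v) (real j) (real k)) \<le> 6 * (y ^ 3 / Q ^ 6)"
    using mult_left_mono[OF curv_pos_ge(1)[OF uv p(1,2) Q_def, of 6] y3] by simp
  also have "\<dots> \<le> 6 * ((16 / 729) / ((real j)\<^sup>2 + (real k)\<^sup>2 - 1) ^ 4)"
  proof (intro mult_left_mono cube_div_sixth_le[OF _ _ _ y(1) y2])
    show "(real j)\<^sup>2 + (real k)\<^sup>2 - 1 + (1 + u) \<le> Q"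
      using curv_pos_ge(2)[OF uv p(1,2) Q_def] s2 by simp
    show "0 < (real j)\<^sup>2 + (real k)\<^sup>2 - 1"
      using quad0_ge(3)[of "real j" "real k"] jk2 by linarith
  qed (use uv in auto)
  finally have P: "- (y ^ 3 * curv 6 (1 + u) (1 - v) (real j) (real k)) \<le> (32 / 243) / ((real j)\<^sup>2 + (real k)\<^sup>2 - 1) ^ 4"
    by simp
  show ?thesis
  proof (cases "j * k = 2")
    case True
    then have "real (j * k) = real 2" by (simp only:)
    then have r2: "real j * real k = 2" by simp
    have "j * 1 \<le> j * k" using jk by (intro mult_le_mono2)
    then have "j = 1 \<or> j = 2" using jk True by linarith
    then have "(real j = 1 \<and> real k = 2) \<or> (real j = 2 \<and> real k = 1)" using True by auto
    from curv6_neg_12[OF uv y this] P show ?thesis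
      by (simp add: off6_def Let_def True r2 algebra_simps)
  next
    case False
    then have "real (j * k) \<noteq> real 2" by (simp only: of_nat_eq_iff not_False_eq_True)
    then have r2: "real j * real k \<noteq> 2" by simp
    have "- (y ^ 3 * curv 6 (1 + u) (1 - v) (real j) (- real k)) \<le> 12 * (y ^ 3 / q ^ 6)"
      using mult_left_mono[OF curv_neg_ge[OF uv p(1,2) q_def, of 6] y3] by simp
    also have "\<dots> \<le> 12 * ((16 / 729) / ((real j)\<^sup>2 + (real k)\<^sup>2 - real j * real k - 1) ^ 4)"
    proof (intro mult_left_mono cube_div_sixth_le[OF _ _ _ y(1) y2])
      show "(real j)\<^sup>2 + (real k)\<^sup>2 - real j * real k - 1 + (1 + u) \<le> q"
        unfolding q_def using s1 s2 by simp
      show "0 < (real j)\<^sup>2 + (real k)\<^sup>2 - real j * real k - 1"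
        using quad0_ge(3)[of "real j" "real k"] jk2 by linarith
    qed (use uv in auto)
    finally show ?thesis using P False r2
      by (simp add: off6_def Let_def algebra_simps)
  qed
qed

text \<open>The constant is twice \<open>0.0285\<close>, from \<open>(1, - 2)\<close> and
  \<open>(2, - 1)\<close>, less \<open>0.0019\<close> for the rest of the first three shells and
  less the tail.\<close>

lemma offcurv6_ge:
  assumes uv: "0 \<le> u" "0 \<le> v" "v \<le> 1" and y: "0 \<le> y" "y\<^sup>2 = (1 + u) - (1 - v)\<^sup>2 / 4" and K: "3 \<le> K"
  shows "0.0548 - 2 * (u + v) \<le> y ^ 3 * sum (offcurv 6 u v) (offdiag K)"
proof -
  define a where "a x = - (y ^ 3 * offcurv 6 u v x)" for x
  have "sum a (offdiag K) \<le> sum a (offdiag 3) + 0.0847 / (2 * (real 3)\<^sup>2 * (real 3 + 1)\<^sup>2)"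
  proof (rule sum_offdiag_le)
    fix j k :: nat assume jk: "1 \<le> j" "1 \<le> k" "j \<noteq> k" "3 < max j k"
    define M where "M = real (max j k)"
    have M: "4 \<le> M" using jk by (auto simp: M_def)
    then have M2: "16 \<le> M\<^sup>2" using power_mono[of 4 M 2] by simp
    have "j * 1 \<le> j * k" "1 * k \<le> j * k" using jk by (intro mult_le_mono; simp)+
    then have n2: "j * k \<noteq> 2" using jk by linarith
    then have "real (j * k) \<noteq> real 2" by (simp only: of_nat_eq_iff not_False_eq_True)
    then have r2: "real j * real k \<noteq> 2" by simp
    have b1: "11 / 16 * M\<^sup>2 \<le> (real j)\<^sup>2 + (real k)\<^sup>2 - real j * real k - 1"
      using max_sq_le(1)[of j k] M2 unfolding M_def by simp
    have b2: "15 / 16 * M\<^sup>2 \<le> (real j)\<^sup>2 + (real k)\<^sup>2 - 1"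
      using max_sq_le(2)[of j k] M2 unfolding M_def by simp
    \<comment> \<open>One factor \<open>M^2 >= 16\<close> is spent to weaken the decay from order
      \<open>8\<close> to the order \<open>6\<close> that \<open>sum_offdiag_le\<close>
      expects.\<close>
    have g: "e / z ^ 4 \<le> e / (16 * c ^ 4) / M ^ 6" if "c * M\<^sup>2 \<le> z" "0 < c" "0 \<le> e" for c e z :: real
    proof -
      have z0: "0 < c * M\<^sup>2" using that M by simp
      then have z: "0 < z" using that by linarith
      have "16 * c ^ 4 * M ^ 6 \<le> M\<^sup>2 * (c ^ 4 * M ^ 6)"
        using mult_right_mono[OF M2, of "c ^ 4 * M ^ 6"] that M by (simp add: mult_ac)
      also have "\<dots> = (c * M\<^sup>2) ^ 4" by algebra
      also have "\<dots> \<le> z ^ 4" using that z0 by (intro power_mono) auto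
      finally have "e / z ^ 4 \<le> e / (16 * c ^ 4 * M ^ 6)"
        using that M z by (intro divide_left_mono mult_pos_pos) auto
      then show ?thesis by simp
    qed
    have "a (j, k) \<le> off6 (j, k)"
      using offcurv6_pair[OF uv y jk(1-3)] n2 by (simp add: a_def)
    also have "\<dots> \<le> (64 / 243) / (16 * (11 / 16) ^ 4) / M ^ 6 + (32 / 243) / (16 * (15 / 16) ^ 4) / M ^ 6"
      using g[OF b1, of "64 / 243"] g[OF b2, of "32 / 243"] r2 by (simp add: off6_def Let_def)
    also have "\<dots> = ((64 / 243) / (16 * (11 / 16) ^ 4) + (32 / 243) / (16 * (15 / 16) ^ 4)) / M ^ 6"
      by (simp add: add_divide_distrib)
    also have "\<dots> \<le> 0.0847 / M ^ 6"
      using M by (intro divide_right_mono) (auto simp: power_numeral_reduce)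
    finally show "a (j, k) \<le> 0.0847 / real (max j k) ^ 6" by (simp add: M_def)
  qed (use K in auto)
  moreover have "sum a (offdiag 3) \<le> (\<Sum>x\<in>offdiag 3. off6 x + (if fst x * snd x = 2 then u + v - 0.0285 else 0))"
  proof (rule sum_mono)
    fix x assume "x \<in> offdiag 3"
    then obtain j k where x: "x = (j, k)" and "1 \<le> j" "1 \<le> k" "j \<noteq> k" by (auto simp: offdiag_def)
    then show "a x \<le> off6 x + (if fst x * snd x = 2 then u + v - 0.0285 else 0)"
      using offcurv6_pair[OF uv y, of j k] by (simp add: a_def)
  qed
  moreover have "(\<Sum>x\<in>offdiag 3. off6 x + (if fst x * snd x = 2 then u + v - 0.0285 else 0))
      = sum off6 (offdiag 3) + (\<Sum>x\<in>offdiag 3. (if fst x * snd x = 2 then u + v - 0.0285 else 0))"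
    by (rule sum.distrib)
  moreover have "(\<Sum>x\<in>offdiag 3. (if fst x * snd x = 2 then u + v - 0.0285 else 0)) = 2 * (u + v - 0.0285)"
    unfolding sum_offdiag_list
    by (simp add: upt_table)
  moreover have "sum a (offdiag K) = - (y ^ 3 * sum (offcurv 6 u v) (offdiag K))"
    unfolding a_def by (simp add: sum_negf sum_distrib_left)
  ultimately show ?thesis using sum_off6_3 by simp
qed

section \<open>Lattice points on the axes and diagonals\<close>

text \<open>This is the estimate in \<open>main_ineq\<close> without the point \<open>(1, 1)\<close>, multiplied by \<open>(1 + u) ^ 6 (1 + u + v) ^ 7\<close>.
  Expanded in powers of \<open>u\<close>, all coefficients are nonnegative for \<open>0 \<le> v \<le> 1\<close>; the constant \<open>280 / 100000\<close>
  is the margin at the hexagonal point.\<close>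

lemma main_polynomial_nonneg:
  fixes u v :: real
  assumes "0 \<le> u" "0 \<le> v" "v \<le> 1"
  defines "Y \<equiv> 0.64967 * (1 + 2 * u + v - v\<^sup>2 / 2)"
  shows "0 \<le> (36 * Y * ((1 + u) ^ 6 + 1) - 9 * 3.1132 * ((1 + u) ^ 6 + (1 + u) ^ 3)
        - (1.619 + 5 * u + 6 * v) * (1 + u) ^ 6) * (1 + u + v) ^ 7
      + (3 * 3.1132 * (2 + u) * (1 + u + v) ^ 3 - 6 * (2 + u) * Y - 12 * 3.1132 * u\<^sup>2 * (1 + u + v)\<^sup>2) * (1 + u) ^ 6"
    (is "0 \<le> ?P")
proof -
  have ch: "v ^ 9 \<le> v ^ 8" "v ^ 8 \<le> v ^ 7" "v ^ 7 \<le> v ^ 6" "v ^ 6 \<le> v ^ 5" "v ^ 5 \<le> v ^ 4"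
    "v ^ 4 \<le> v ^ 3" "v ^ 3 \<le> v ^ 2" "v ^ 2 \<le> v ^ 1"
    by (rule power_decreasing; use assms in simp)+
  have n: "0 \<le> v ^ 9" "v ^ 1 = v" using assms by simp_all
  have r0: "(0::real) \<le> 280 + 1285528 * v + 9349362 * v ^ 2 + 33045080 * v ^ 3 + 55520528 * v ^ 4
      + 38009664 * v ^ 5 - 3844568 * v ^ 6 - 21659720 * v ^ 7 - 12294060 * v ^ 8 - 2338812 * v ^ 9"
    using ch n by linarith
  have r1: "(0::real) \<le> 202154 + 12741862 * v + 81916125 * v ^ 2 + 244205116 * v ^ 3
      + 313346684 * v ^ 4 + 105290388 * v ^ 5 - 131517652 * v ^ 6 - 147301988 * v ^ 7 - 55053864 * v ^ 8
      - 7016436 * v ^ 9"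
    using ch n by linarith
  have r2: "(0::real) \<le> 9082624 + 140705064 * v + 651696630 * v ^ 2 + 1434527618 * v ^ 3
      + 1427770890 * v ^ 4 + 340628778 * v ^ 5 - 496804994 * v ^ 6 - 449277306 * v ^ 7
      - 145820502 * v ^ 8 - 17541090 * v ^ 9"
    using ch n by linarith
  have r3: "(0::real) \<le> 102113014 + 1036371310 * v + 3711182709 * v ^ 2 + 6435223740 * v ^ 3
      + 5370970290 * v ^ 4 + 1350059508 * v ^ 5 - 1051599010 * v ^ 6 - 901849396 * v ^ 7
      - 251728230 * v ^ 8 - 23388120 * v ^ 9"
    using ch n by linarith
  have r4: "(0::real) \<le> 551967524 + 4395093400 * v + 12894960810 * v ^ 2 + 18424389780 * v ^ 3
      + 12854190930 * v ^ 4 + 2732083074 * v ^ 5 - 1750239260 * v ^ 6 - 1218839920 * v ^ 7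
      - 260422290 * v ^ 8 - 17541090 * v ^ 9"
    using ch n by linarith
  have r5: "(0::real) \<le> 1783750462 + 11653641834 * v + 28487660547 * v ^ 2 + 33709637760 * v ^ 3
      + 19045005462 * v ^ 4 + 2701305432 * v ^ 5 - 2180589964 * v ^ 6 - 1060701540 * v ^ 7
      - 161469810 * v ^ 8 - 7016436 * v ^ 9"
    using ch n by linarith
  have r6: "(0::real) \<le> 3819271704 + 20733137304 * v + 42210301746 * v ^ 2 + 40872190134 * v ^ 3
      + 17922541308 * v ^ 4 + 1062377820 * v ^ 5 - 1832144888 * v ^ 6 - 577968164 * v ^ 7
      - 55562082 * v ^ 8 - 1169406 * v ^ 9"
    using ch n by linarith
  have r7: "(0::real) \<le> 5725078362 + 25834846890 * v + 43364664375 * v ^ 2 + 33550319256 * v ^ 3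
      + 10693781700 * v ^ 4 - 369153792 * v ^ 5 - 981002344 * v ^ 6 - 180110900 * v ^ 7
      - 8185842 * v ^ 8"
    using ch n by linarith
  have r8: "(0::real) \<le> 6188112708 + 23032282980 * v + 31245604818 * v ^ 2 + 18534687990 * v ^ 3
      + 3753578430 * v ^ 4 - 605372166 * v ^ 5 - 302604470 * v ^ 6 - 24557526 * v ^ 7"
    using ch n by linarith
  have r9: "(0::real) \<le> 4882118008 + 14731984060 * v + 15595274310 * v ^ 2 + 6568461620 * v ^ 3
      + 551997950 * v ^ 4 - 260703576 * v ^ 5 - 40929210 * v ^ 6"
    using ch n by linarith
  have r10: "(0::real) \<le> 2802656552 + 6642105976 * v + 5149669140 * v ^ 2 + 1301694520 * v ^ 3
      - 63057526 * v ^ 4 - 40929210 * v ^ 5"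
    using ch n by linarith
  have r11: "(0::real) \<le> 1146052960 + 2013192312 * v + 1006753356 * v ^ 2 + 84501788 * v ^ 3
      - 24557526 * v ^ 4"
    using ch n by linarith
  have r12: "(0::real) \<le> 317730088 + 369150196 * v + 84699510 * v ^ 2 - 8185842 * v ^ 3"
    using ch n by linarith
  have r13: "(0::real) \<le> 53684144 + 30982180 * v - 1169406 * v ^ 2"
    using ch n by linarith
  have r14: "(0::real) \<le> 4177624"
    using assms by simp
  have "100000 * ?P = (280 + 1285528 * v + 9349362 * v ^ 2 + 33045080 * v ^ 3 + 55520528 * v ^ 4
      + 38009664 * v ^ 5 - 3844568 * v ^ 6 - 21659720 * v ^ 7 - 12294060 * v ^ 8 - 2338812 * v ^ 9)
      + u * (202154 + 12741862 * v + 81916125 * v ^ 2 + 244205116 * v ^ 3 + 313346684 * v ^ 4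
        + 105290388 * v ^ 5 - 131517652 * v ^ 6 - 147301988 * v ^ 7 - 55053864 * v ^ 8
        - 7016436 * v ^ 9)
      + u ^ 2 * (9082624 + 140705064 * v + 651696630 * v ^ 2 + 1434527618 * v ^ 3 + 1427770890 * v ^ 4
        + 340628778 * v ^ 5 - 496804994 * v ^ 6 - 449277306 * v ^ 7 - 145820502 * v ^ 8
        - 17541090 * v ^ 9)
      + u ^ 3 * (102113014 + 1036371310 * v + 3711182709 * v ^ 2 + 6435223740 * v ^ 3
        + 5370970290 * v ^ 4 + 1350059508 * v ^ 5 - 1051599010 * v ^ 6 - 901849396 * v ^ 7
        - 251728230 * v ^ 8 - 23388120 * v ^ 9)
      + u ^ 4 * (551967524 + 4395093400 * v + 12894960810 * v ^ 2 + 18424389780 * v ^ 3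
        + 12854190930 * v ^ 4 + 2732083074 * v ^ 5 - 1750239260 * v ^ 6 - 1218839920 * v ^ 7
        - 260422290 * v ^ 8 - 17541090 * v ^ 9)
      + u ^ 5 * (1783750462 + 11653641834 * v + 28487660547 * v ^ 2 + 33709637760 * v ^ 3
        + 19045005462 * v ^ 4 + 2701305432 * v ^ 5 - 2180589964 * v ^ 6 - 1060701540 * v ^ 7
        - 161469810 * v ^ 8 - 7016436 * v ^ 9)
      + u ^ 6 * (3819271704 + 20733137304 * v + 42210301746 * v ^ 2 + 40872190134 * v ^ 3
        + 17922541308 * v ^ 4 + 1062377820 * v ^ 5 - 1832144888 * v ^ 6 - 577968164 * v ^ 7
        - 55562082 * v ^ 8 - 1169406 * v ^ 9)
      + u ^ 7 * (5725078362 + 25834846890 * v + 43364664375 * v ^ 2 + 33550319256 * v ^ 3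
        + 10693781700 * v ^ 4 - 369153792 * v ^ 5 - 981002344 * v ^ 6 - 180110900 * v ^ 7
        - 8185842 * v ^ 8)
      + u ^ 8 * (6188112708 + 23032282980 * v + 31245604818 * v ^ 2 + 18534687990 * v ^ 3
        + 3753578430 * v ^ 4 - 605372166 * v ^ 5 - 302604470 * v ^ 6 - 24557526 * v ^ 7)
      + u ^ 9 * (4882118008 + 14731984060 * v + 15595274310 * v ^ 2 + 6568461620 * v ^ 3
        + 551997950 * v ^ 4 - 260703576 * v ^ 5 - 40929210 * v ^ 6)
      + u ^ 10 * (2802656552 + 6642105976 * v + 5149669140 * v ^ 2 + 1301694520 * v ^ 3
        - 63057526 * v ^ 4 - 40929210 * v ^ 5)
      + u ^ 11 * (1146052960 + 2013192312 * v + 1006753356 * v ^ 2 + 84501788 * v ^ 3 - 24557526 * v ^ 4)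
      + u ^ 12 * (317730088 + 369150196 * v + 84699510 * v ^ 2 - 8185842 * v ^ 3)
      + u ^ 13 * (53684144 + 30982180 * v - 1169406 * v ^ 2)
      + u ^ 14 * (4177624)"
    unfolding Y_def by (simp add: field_simps) algebra
  also have "\<dots> \<ge> 0"
    by (intro add_nonneg_nonneg mult_nonneg_nonneg zero_le_power assms r0 r1 r2 r3 r4 r5 r6 r7 r8 r9 r10 r11 r12 r13 r14)
  finally have "0 \<le> 100000 * ?P" .
  moreover have "0 \<le> x" if "0 \<le> 100000 * x" for x :: real using that by simp
  ultimately show ?thesis by blast
qed

text \<open>This is the share of \<open>(1, 1)\<close>, where the form is \<open>3 + u - v\<close>;
  at the hexagonal point it is about \<open>0.22704\<close>. Clearing its denominators as well would
  raise the degree of the polynomial above, and a linear bound is enough.\<close>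

lemma diagonal_11_ge:
  fixes u v :: real
  assumes uv: "0 \<le> u" "0 \<le> v" "v \<le> 1"
  defines "Y \<equiv> 0.64967 * (1 + 2 * u + v - v\<^sup>2 / 2)" and "x \<equiv> 1 / (3 + u - v)"
  shows "0.2270 - 1.5 * u - 1.5 * v
    \<le> 3 * 3.1132 * (2 + u) * x ^ 4 - 6 * (2 + u) * Y * x ^ 7 - 12 * 3.1132 * u\<^sup>2 * x ^ 5"
proof -
  have x: "0 < x" "x \<le> 1 / (2 + u)" "1 / (3 + u) \<le> x"
    using uv by (auto simp: x_def frac_le)
  have Y: "0 \<le> Y" "Y \<le> 0.64967 * (1 + 2 * u + v)"
  proof -
    have "v\<^sup>2 / 2 \<le> v" using uv by (simp add: power2_eq_square mult_left_le_one_le order_trans[of _ "v * 1"] mult_left_mono)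
    then show "0 \<le> Y" using uv by (simp add: Y_def)
  qed (simp add: Y_def)
  have u2: "12 * 3.1132 * u\<^sup>2 * x ^ 5 \<le> 0.2 * u"
  proof -
    have "x ^ 5 \<le> (1 / (2 + u)) ^ 5" using x by (intro power_mono) auto
    \<comment> \<open>The maximum of \<open>u / (2 + u) ^ 5\<close> is \<open>0.00512\<close>,
      attained at \<open>u = 1/2\<close>; Bernoulli's inequality is used as the tangent line
      there.\<close>
    moreover have "u * (1 / (2 + u)) ^ 5 \<le> 0.00512"
    proof -
      have "1 + real 5 * ((2 * u - 1) / 5) \<le> (1 + (2 * u - 1) / 5) ^ 5"
        by (rule Bernoulli_inequality) (use uv in auto)
      then have "2 * u \<le> ((4 + 2 * u) / 5) ^ 5" by (simp add: field_simps)
      also have "(4 + 2 * u) / 5 = 2 / 5 * (2 + u)" by simp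
      also have "(2 / 5 * (2 + u)) ^ 5 = 32 / 3125 * (2 + u) ^ 5" unfolding power_mult_distrib by (simp add: power_divide)
      finally have "u \<le> 0.00512 * (2 + u) ^ 5" by simp
      then show ?thesis using uv by (simp add: power_one_over divide_le_eq)
    qed
    ultimately have "u * x ^ 5 \<le> 0.00512"
      using uv mult_left_mono[of "x ^ 5" "(1 / (2 + u)) ^ 5" u] by linarith
    then have "12 * 3.1132 * u * (u * x ^ 5) \<le> 12 * 3.1132 * u * 0.00512"
      using uv by (intro mult_left_mono) auto
    also have "\<dots> \<le> 0.2 * u" using uv by simp
    finally show ?thesis by (simp add: power2_eq_square mult_ac)
  qed
  have yx: "Y * x ^ 3 \<le> 0.2"
  proof -
    have "x ^ 3 \<le> (1 / (2 + u)) ^ 3" using x by (intro power_mono) auto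
    then have "Y * x ^ 3 \<le> 0.64967 * (1 + 2 * u + v) * (1 / (2 + u)) ^ 3"
      using Y uv x by (intro mult_mono) auto
    also have "\<dots> \<le> 0.64967 * (2 + 2 * u) * (1 / (2 + u)) ^ 3"
      using uv by (intro mult_right_mono) auto
    also have "\<dots> \<le> 0.2"
    proof -
      have "0 \<le> u ^ 3" "0 \<le> u\<^sup>2" using uv by simp_all
      then have "6.4967 * (1 + u) \<le> (2 + u) ^ 3" using uv by (simp add: power_numeral_reduce algebra_simps)
      then show ?thesis using uv by (simp add: power_one_over divide_le_eq)
    qed
    finally show ?thesis .
  qed
  have e: "3 * 3.1132 * (2 + u) * x ^ 4 - 6 * (2 + u) * Y * x ^ 7 = (2 + u) * (3 * x ^ 4) * (3.1132 - 2 * (Y * x ^ 3))"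
    by (simp add: algebra_simps power_numeral_reduce)
  have pos: "0 \<le> (2 + u) * (3 * x ^ 4)" using uv x by simp
  show ?thesis
  proof (cases "u + v \<le> 0.18")
    \<comment> \<open>For \<open>u + v > 0.18\<close> the left side is below
      \<open>- 0.2 * u\<close>, so \<open>u2\<close> and the sign of the other terms
      suffice.\<close>
    case False
    have "0 \<le> (2 + u) * (3 * x ^ 4) * (3.1132 - 2 * (Y * x ^ 3))"
      using yx by (intro mult_nonneg_nonneg pos) simp
    then show ?thesis using False u2 uv unfolding e by simp
  next
    case True
    define w where "w = u + v"
    have w: "0 \<le> w" "w \<le> 0.18" "u \<le> w" "v \<le> w" using True uv by (auto simp: w_def)
    have "1 / (3 + w) \<le> x" "x \<le> 1 / (3 - w)"
      unfolding x_def using uv w by (auto intro!: divide_left_mono mult_pos_pos)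
    have "(1 - 4 / 3 * w) / 81 \<le> x ^ 4"
    proof -
      have "1 + real 4 * (- (w / 3)) \<le> (1 + - (w / 3)) ^ 4"
        by (rule Bernoulli_inequality) (use w in auto)
      also have "\<dots> \<le> (3 * x) ^ 4"
      proof (rule power_mono)
        have "(1 - w / 3) * (3 + w) \<le> 3" by (simp add: algebra_simps)
        then have "1 - w / 3 \<le> 3 * (1 / (3 + w))" using w by (simp add: pos_le_divide_eq)
        then show "1 + - (w / 3) \<le> 3 * x" using \<open>1 / (3 + w) \<le> x\<close> by linarith
      qed (use w in auto)
      finally show ?thesis by (simp add: power_mult_distrib)
    qed
    \<comment> \<open>The constant \<open>0.0240625\<close> is just above
      \<open>0.64967 / 27\<close>, the value at \<open>w = 0\<close>.\<close>
    moreover have "Y * x ^ 3 \<le> 0.0240625 * (1 + 4 * w)"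
    proof -
      have "x ^ 3 \<le> (1 / (3 - w)) ^ 3" using x \<open>x \<le> 1 / (3 - w)\<close> by (intro power_mono) auto
      moreover have "Y \<le> 0.64967 * (1 + 2 * w)" using Y uv by (simp add: w_def)
      ultimately have "Y * x ^ 3 \<le> 0.64967 * (1 + 2 * w) * (1 / (3 - w)) ^ 3"
        using Y x w by (intro mult_mono) auto
      also have "\<dots> \<le> 0.0240625 * (1 + 4 * w)"
      proof -
        have "0 \<le> w * w * (9 - w)" using w by (intro mult_nonneg_nonneg) auto
        then have b: "27 * (1 - w) \<le> (3 - w) ^ 3"
          by (simp add: power_numeral_reduce algebra_simps)
        have "w * w \<le> w * 0.18" using w by (intro mult_left_mono) auto
        then have "1 + 2 * w \<le> (1 + 4 * w) * (1 - w)" using w by (simp add: algebra_simps)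
        then have "0.64967 * (1 + 2 * w) \<le> 0.0240625 * 27 * ((1 + 4 * w) * (1 - w))" using w by simp
        also have "\<dots> = 0.0240625 * (1 + 4 * w) * (27 * (1 - w))" by (simp add: algebra_simps)
        also have "\<dots> \<le> 0.0240625 * (1 + 4 * w) * (3 - w) ^ 3" using b w by (intro mult_left_mono) auto
        finally show ?thesis using w by (simp add: power_one_over pos_divide_le_eq)
      qed
      finally show ?thesis .
    qed
    ultimately have "2 * (3 * ((1 - 4 / 3 * w) / 81)) * (3.1132 - 2 * (0.0240625 * (1 + 4 * w)))
        \<le> (2 + u) * (3 * x ^ 4) * (3.1132 - 2 * (Y * x ^ 3))"
      using uv w x by (intro mult_mono) auto
    moreover have "0.2270 - 0.4 * w \<le> 2 * (3 * ((1 - 4 / 3 * w) / 81)) * (3.1132 - 2 * (0.0240625 * (1 + 4 * w)))"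
    proof -
      define t where "t = w * (1 - 4 / 3 * w)"
      have "t \<le> w * 1" unfolding t_def using w by (intro mult_left_mono) auto
      then have "227 / 1000 - 2 / 5 * w \<le> 2 / 27 * (122603 / 40000 * (1 - 4 / 3 * w) - 77 / 400 * t)"
        using w(1) by argo
      also have "\<dots> = 2 * (3 * ((1 - 4 / 3 * w) / 81)) * (3.1132 - 2 * (0.0240625 * (1 + 4 * w)))"
        by (simp add: t_def field_simps)
      finally show ?thesis by simp
    qed
    ultimately have f: "0.2270 - 0.4 * w \<le> (2 + u) * (3 * x ^ 4) * (3.1132 - 2 * (Y * x ^ 3))" by linarith
    have "0.2270 - 1.5 * u - 1.5 * v \<le> S - T" if "0.2270 - 0.4 * w \<le> S" "T \<le> 0.2 * u" for S T
      using that uv by (simp add: w_def) argo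
    from this[OF f u2] show ?thesis unfolding e .
  qed
qed

lemma curv_diagonal:
  "curv 3 (1 + u) (1 - v) 1 (- 1) = 12 * u\<^sup>2 / (1 + u + v) ^ 5 - 3 * (2 + u) / (1 + u + v) ^ 4"
  "curv 3 (1 + u) (1 - v) 1 1 = 12 * u\<^sup>2 / (3 + u - v) ^ 5 - 3 * (2 + u) / (3 + u - v) ^ 4"
  "curv 6 (1 + u) (1 - v) 1 (- 1) = 42 * u\<^sup>2 / (1 + u + v) ^ 8 - 6 * (2 + u) / (1 + u + v) ^ 7"
  "curv 6 (1 + u) (1 - v) 1 1 = 42 * u\<^sup>2 / (3 + u - v) ^ 8 - 6 * (2 + u) / (3 + u - v) ^ 7"
  by (simp_all add: curv_def add_ac add_diff_eq)

lemma curv_axis: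
  assumes "\<rho> \<noteq> 0"
  shows "curv s \<rho> \<tau> 1 0 = (real s)\<^sup>2 / \<rho> ^ s" "curv s \<rho> \<tau> 0 1 = (real s)\<^sup>2"
  using assms by (simp_all add: curv_def field_simps power2_eq_square)

text \<open>The points on the axes and diagonals are the multiples of \<open>(1, 0)\<close>, \<open>(0, 1)\<close>, \<open>(1, - 1)\<close>, \<open>(1, 1)\<close>,
  whose contributions add up to \<open>main3\<close> and \<open>main6\<close>.\<close>

definition main3 :: "real \<Rightarrow> real \<Rightarrow> real" where
  "main3 u v = 9 + 9 / (1 + u) ^ 3
     + (12 * u\<^sup>2 / (1 + u + v) ^ 5 - 3 * (2 + u) / (1 + u + v) ^ 4)
     + (12 * u\<^sup>2 / (3 + u - v) ^ 5 - 3 * (2 + u) / (3 + u - v) ^ 4)"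

definition main6 :: "real \<Rightarrow> real \<Rightarrow> real" where
  "main6 u v = 36 + 36 / (1 + u) ^ 6
     + (42 * u\<^sup>2 / (1 + u + v) ^ 8 - 6 * (2 + u) / (1 + u + v) ^ 7)
     + (42 * u\<^sup>2 / (3 + u - v) ^ 8 - 6 * (2 + u) / (3 + u - v) ^ 7)"

lemma ratio_power_le_2:
  fixes u z :: real
  assumes "0 \<le> u" "1 + u \<le> z" "1 \<le> n"
  shows "(2 + u) / z ^ n \<le> 2"
proof -
  have "z ^ 1 \<le> z ^ n" using assms by (intro power_increasing) auto
  then have "2 + u \<le> 2 * z ^ n" using assms by simp
  moreover have "0 < z ^ n" using assms by simp
  ultimately show ?thesis by (simp add: pos_divide_le_eq)
qed

text \<open>The signs allow the partial zeta sums to be replaced by constants. In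
  \<open>main3\<close> the axes give at least \<open>9\<close>, and the diagonals cost at most
  \<open>6\<close> and \<open>3/4\<close>; \<open>11/5\<close> is exactly what
  \<open>offcurv3_ge\<close> may take away.\<close>

lemma main_pos:
  assumes uv: "0 \<le> u" "0 \<le> v" "v \<le> 1"
  shows "11 / 5 \<le> main3 u v" "0 \<le> main6 u v"
proof -
  have a: "(2 + u) / (1 + u + v) ^ n \<le> 2" if "1 \<le> n" for n
    by (rule ratio_power_le_2) (use uv that in auto)
  have b: "(2 + u) / (3 + u - v) ^ n \<le> 1 / 4" if "3 \<le> n" for n
  proof -
    have z: "2 + u \<le> 3 + u - v" "2 \<le> 3 + u - v" using uv by auto
    have "2 ^ 2 * (3 + u - v) \<le> (3 + u - v) ^ 2 * (3 + u - v)"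
      using z by (intro mult_right_mono power_mono) auto
    also have "\<dots> = (3 + u - v) ^ 3" by (simp add: power_numeral_reduce)
    also have "\<dots> \<le> (3 + u - v) ^ n" using that z by (intro power_increasing) auto
    finally have "2 + u \<le> 1 / 4 * (3 + u - v) ^ n" using z by simp
    moreover have "0 < (3 + u - v) ^ n" using z by simp
    ultimately show ?thesis by (simp add: pos_divide_le_eq)
  qed
  have p: "0 < 1 + u" "0 < 1 + u + v" "0 < 3 + u - v" using uv by auto
  have n: "0 \<le> 9 / (1 + u) ^ 3" "0 \<le> 12 * u\<^sup>2 / (1 + u + v) ^ 5" "0 \<le> 12 * u\<^sup>2 / (3 + u - v) ^ 5"
     "0 \<le> 36 / (1 + u) ^ 6" "0 \<le> 42 * u\<^sup>2 / (1 + u + v) ^ 8" "0 \<le> 42 * u\<^sup>2 / (3 + u - v) ^ 8"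
    using p by simp_all
  have c: "c * (2 + u) / D = c * ((2 + u) / D)" for c D by simp
  show "11 / 5 \<le> main3 u v" using n a[of 4] b[of 4] unfolding main3_def c by linarith
  show "0 \<le> main6 u v" using n a[of 7] b[of 7] unfolding main6_def c by linarith
qed

text \<open>The estimates without \<open>(1, 1)\<close> and for \<open>(1, 1)\<close> add up:
  \<open>1.619 + 0.2270\<close>, with slopes \<open>5 - 1.5\<close> and \<open>6 - 1.5\<close>. The
  nonnegative \<open>42 u^2\<close> terms of \<open>main6\<close> are dropped.\<close>

lemma main_ineq:
  assumes uv: "0 \<le> u" "0 \<le> v" "v \<le> 1"
  shows "1.846 + 3.5 * u + 4.5 * v
    \<le> 0.64967 * (1 + 2 * u + v - v\<^sup>2 / 2) * main6 u v - 3.1132 * main3 u v"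
proof -
  define Y where "Y = 0.64967 * (1 + 2 * u + v - v\<^sup>2 / 2)"
  define B :: real where "B = 3.1132"
  define r where "r = 1 + u"
  define z where "z = 1 + u + v"
  define t where "t = 3 + u - v"
  have p: "0 < r" "0 < z" "0 < t" using uv by (auto simp: r_def z_def t_def)
  have "v\<^sup>2 \<le> 1" using uv by (simp add: power_le_one)
  then have Y0: "0 \<le> Y" using uv by (simp add: Y_def)
  have "0 \<le> (36 * Y * (r ^ 6 + 1) - 9 * B * (r ^ 6 + r ^ 3) - (1.619 + 5 * u + 6 * v) * r ^ 6) * z ^ 7
      + (3 * B * (2 + u) * z ^ 3 - 6 * (2 + u) * Y - 12 * B * u\<^sup>2 * z\<^sup>2) * r ^ 6" (is "0 \<le> ?P")
    using main_polynomial_nonneg[OF uv] unfolding Y_def B_def r_def z_def .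
  then have "0 \<le> ?P / (r ^ 6 * z ^ 7)" using p by simp
  also have "\<dots> = 36 * Y * (1 + 1 / r ^ 6) - 9 * B * (1 + 1 / r ^ 3) - (1.619 + 5 * u + 6 * v)
      + 3 * B * (2 + u) / z ^ 4 - 6 * (2 + u) * Y / z ^ 7 - 12 * B * u\<^sup>2 / z ^ 5"
    using p by (simp add: divide_simps power_numeral_reduce) (simp add: algebra_simps)
  finally have 1: "1.619 + 5 * u + 6 * v \<le> 36 * Y * (1 + 1 / r ^ 6) - 9 * B * (1 + 1 / r ^ 3)
      + 3 * B * (2 + u) / z ^ 4 - 6 * (2 + u) * Y / z ^ 7 - 12 * B * u\<^sup>2 / z ^ 5" by simp
  have 2: "0.2270 - 1.5 * u - 1.5 * v
    \<le> 3 * B * (2 + u) / t ^ 4 - 6 * (2 + u) * Y / t ^ 7 - 12 * B * u\<^sup>2 / t ^ 5"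
    using diagonal_11_ge[OF uv] unfolding Y_def B_def t_def by (simp add: power_one_over)
  have 3: "0 \<le> Y * (42 * u\<^sup>2 / z ^ 8)" "0 \<le> Y * (42 * u\<^sup>2 / t ^ 8)" using Y0 p by simp_all
  have "Y * main6 u v - B * main3 u v =
      (36 * Y * (1 + 1 / r ^ 6) - 9 * B * (1 + 1 / r ^ 3)
        + 3 * B * (2 + u) / z ^ 4 - 6 * (2 + u) * Y / z ^ 7 - 12 * B * u\<^sup>2 / z ^ 5)
      + (3 * B * (2 + u) / t ^ 4 - 6 * (2 + u) * Y / t ^ 7 - 12 * B * u\<^sup>2 / t ^ 5)
      + Y * (42 * u\<^sup>2 / z ^ 8) + Y * (42 * u\<^sup>2 / t ^ 8)"
    unfolding main3_def main6_def z_def[symmetric] t_def[symmetric] unfolding r_def[symmetric]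
    by (simp add: field_simps)
  with 1 2 3 show ?thesis unfolding Y_def[symmetric] B_def[symmetric] by simp
qed

section \<open>Sums over squares\<close>

definition lattice_box :: "nat \<Rightarrow> (int \<times> int) set" where
  "lattice_box K = {- int K..int K} \<times> {- int K..int K} - {(0, 0)}"

lemma finite_lattice_box [simp]: "finite (lattice_box K)"
  by (simp add: lattice_box_def)

lemma sum_symmetric_interval:
  fixes g :: "int \<Rightarrow> real"
  shows "(\<Sum>m = - int K..int K. g m) = g 0 + (\<Sum>k = 1..K. g (int k) + g (- int k))"
proof (induction K)
  case (Suc K)
  have "{- int (Suc K)..int (Suc K)} = insert (int (Suc K)) (insert (- int (Suc K)) {- int K..int K})"
    by auto
  then have "(\<Sum>m = - int (Suc K)..int (Suc K). g m)
      = g (int (Suc K)) + (g (- int (Suc K)) + (\<Sum>m = - int K..int K. g m))"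
    by (simp del: of_nat_Suc)
  then show ?case using Suc.IH by simp
qed simp

lemma sum_offdiag_square:
  fixes G :: "nat \<times> nat \<Rightarrow> real"
  shows "(\<Sum>j = 1..K. \<Sum>k = 1..K. G (j, k)) = (\<Sum>k = 1..K. G (k, k)) + sum G (offdiag K)"
proof -
  have eq: "{1..K} \<times> {1..K} = (\<lambda>k. (k, k)) ` {1..K} \<union> offdiag K" by (auto simp: offdiag_def)
  have "(\<Sum>j = 1..K. \<Sum>k = 1..K. G (j, k)) = sum G ({1..K} \<times> {1..K})"
    by (simp add: sum.cartesian_product)
  also have "\<dots> = sum G ((\<lambda>k. (k, k)) ` {1..K}) + sum G (offdiag K)"
    unfolding eq by (rule sum.union_disjoint) (auto, auto simp: offdiag_def)
  also have "sum G ((\<lambda>k. (k, k)) ` {1..K}) = (\<Sum>k = 1..K. G (k, k))"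
    by (simp add: sum.reindex inj_on_def)
  finally show ?thesis .
qed

text \<open>Central symmetry leaves the rows \<open>m > 0\<close> and half of the row
  \<open>m = 0\<close>.\<close>

lemma sum_lattice_box:
  fixes F :: "int \<Rightarrow> int \<Rightarrow> real"
  assumes even: "\<And>m n. F (- m) (- n) = F m n"
  shows "(\<Sum>(m, n)\<in>lattice_box K. F m n) =
    2 * ((\<Sum>k = 1..K. F (int k) 0 + F 0 (int k) + F (int k) (- int k) + F (int k) (int k))
      + (\<Sum>(j, k)\<in>offdiag K. F (int j) (- int k) + F (int j) (int k)))"
proof -
  let ?I = "{- int K..int K}"
  have r: "(\<Sum>n\<in>?I. F (- m) n) = (\<Sum>n\<in>?I. F m n)" for m
  proof -
    have "F (- m) n = F m (- n)" for n using even[of m "- n"] by simp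
    then show ?thesis by (intro sum.reindex_bij_witness[of _ uminus uminus]) auto
  qed
  have c: "(\<Sum>n\<in>?I. F m n) = F m 0 + (\<Sum>k = 1..K. F m (- int k) + F m (int k))" for m
    unfolding sum_symmetric_interval by (simp add: add.commute)
  have c0: "F 0 (- int k) = F 0 (int k)" for k using even[of 0 "int k"] by simp
  have "(\<Sum>(m, n)\<in>lattice_box K. F m n) = (\<Sum>(m, n)\<in>?I \<times> ?I. F m n) - F 0 0"
    unfolding lattice_box_def by (subst sum_diff1) auto
  also have "(\<Sum>(m, n)\<in>?I \<times> ?I. F m n) = (\<Sum>m\<in>?I. \<Sum>n\<in>?I. F m n)"
    by (simp add: sum.cartesian_product)
  also have "\<dots> = (\<Sum>n\<in>?I. F 0 n) + 2 * (\<Sum>j = 1..K. \<Sum>n\<in>?I. F (int j) n)"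
    unfolding sum_symmetric_interval[of "\<lambda>m. \<Sum>n\<in>?I. F m n"] r by (simp add: sum_distrib_left)
  also have "\<dots> - F 0 0 = 2 * ((\<Sum>k = 1..K. F 0 (int k)) + (\<Sum>k = 1..K. F (int k) 0)
      + (\<Sum>j = 1..K. \<Sum>k = 1..K. F (int j) (- int k) + F (int j) (int k)))"
    unfolding c c0 by (simp add: sum.distrib sum_distrib_left)
  also have "(\<Sum>j = 1..K. \<Sum>k = 1..K. F (int j) (- int k) + F (int j) (int k))
      = (\<Sum>k = 1..K. F (int k) (- int k) + F (int k) (int k))
        + (\<Sum>(j, k)\<in>offdiag K. F (int j) (- int k) + F (int j) (int k))"
    using sum_offdiag_square[of "\<lambda>(j, k). F (int j) (- int k) + F (int j) (int k)" K] by simp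
  finally show ?thesis by (simp add: sum.distrib algebra_simps)
qed

text \<open>By homogeneity of degree \<open>- 2 s\<close>, each of the four lines through the origin
  contributes its primitive point times a partial zeta sum.\<close>

lemma sum_lattice_box_curv:
  assumes "0 \<le> u"
  shows "(\<Sum>(m, n)\<in>lattice_box K. curv s (1 + u) (1 - v) (of_int m) (of_int n)) =
    2 * ((\<Sum>k = 1..K. 1 / real k ^ (2 * s)) *
        ((real s)\<^sup>2 / (1 + u) ^ s + (real s)\<^sup>2
          + curv s (1 + u) (1 - v) 1 (- 1) + curv s (1 + u) (1 - v) 1 1)
      + sum (offcurv s u v) (offdiag K))"
proof -
  let ?c = "curv s (1 + u) (1 - v)"
  have sc: "?c (real k) 0 + ?c 0 (real k) + ?c (real k) (- real k) + ?c (real k) (real k)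
      = 1 / real k ^ (2 * s) * ((real s)\<^sup>2 / (1 + u) ^ s + (real s)\<^sup>2 + ?c 1 (- 1) + ?c 1 1)"
    if "k \<in> {1..K}" for k
  proof -
    have k: "real k \<noteq> 0" using that by auto
    have "1 + u \<noteq> 0" using assms by simp
    note ax = curv_axis[OF this, of s "1 - v"]
    show ?thesis
      using curv_scale[OF k, of s "1 + u" "1 - v" 1 0] curv_scale[OF k, of s "1 + u" "1 - v" 0 1]
        curv_scale[OF k, of s "1 + u" "1 - v" 1 "- 1"] curv_scale[OF k, of s "1 + u" "1 - v" 1 1]
      by (simp add: ax add_divide_distrib)
  qed
  have "(\<Sum>(m, n)\<in>lattice_box K. ?c (of_int m) (of_int n)) =
    2 * ((\<Sum>k = 1..K. ?c (real k) 0 + ?c 0 (real k) + ?c (real k) (- real k) + ?c (real k) (real k))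
      + (\<Sum>(j, k)\<in>offdiag K. ?c (real j) (- real k) + ?c (real j) (real k)))"
    by (subst sum_lattice_box) (simp_all add: curv_minus)
  also have "(\<Sum>k = 1..K. ?c (real k) 0 + ?c 0 (real k) + ?c (real k) (- real k) + ?c (real k) (real k))
    = (\<Sum>k = 1..K. 1 / real k ^ (2 * s) * ((real s)\<^sup>2 / (1 + u) ^ s + (real s)\<^sup>2 + ?c 1 (- 1) + ?c 1 1))"
    by (rule sum.cong[OF refl sc])
  finally show ?thesis unfolding sum_distrib_right .
qed

lemma sum_lattice_box_curv_3_6:
  assumes "0 \<le> u"
  shows "(\<Sum>(m, n)\<in>lattice_box K. curv 3 (1 + u) (1 - v) (of_int m) (of_int n)) =
      2 * ((\<Sum>k = 1..K. 1 / real k ^ 6) * main3 u v + sum (offcurv 3 u v) (offdiag K))"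
    and "(\<Sum>(m, n)\<in>lattice_box K. curv 6 (1 + u) (1 - v) (of_int m) (of_int n)) =
      2 * ((\<Sum>k = 1..K. 1 / real k ^ 12) * main6 u v + sum (offcurv 6 u v) (offdiag K))"
proof -
  have "main3 u v = (real 3)\<^sup>2 / (1 + u) ^ 3 + (real 3)\<^sup>2
      + curv 3 (1 + u) (1 - v) 1 (- 1) + curv 3 (1 + u) (1 - v) 1 1"
    "main6 u v = (real 6)\<^sup>2 / (1 + u) ^ 6 + (real 6)\<^sup>2
      + curv 6 (1 + u) (1 - v) 1 (- 1) + curv 6 (1 + u) (1 - v) 1 1"
    unfolding main3_def main6_def curv_diagonal by simp_all
  then show "(\<Sum>(m, n)\<in>lattice_box K. curv 3 (1 + u) (1 - v) (of_int m) (of_int n)) =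
      2 * ((\<Sum>k = 1..K. 1 / real k ^ 6) * main3 u v + sum (offcurv 3 u v) (offdiag K))"
    "(\<Sum>(m, n)\<in>lattice_box K. curv 6 (1 + u) (1 - v) (of_int m) (of_int n)) =
      2 * ((\<Sum>k = 1..K. 1 / real k ^ 12) * main6 u v + sum (offcurv 6 u v) (offdiag K))"
    using sum_lattice_box_curv[OF assms, where s = 3 and K = K and v = v] sum_lattice_box_curv[OF assms, where s = 6 and K = K and v = v]
    by (simp_all only: mult_numeral_1 numeral_times_numeral semiring_norm)
qed

section \<open>Partial zeta sums and the convexity inequality\<close>

lemma zeta_6_partial_le:
  assumes "6 \<le> K"
  shows "(\<Sum>k = 1..K. 1 / real k ^ 6) \<le> 101737 / 100000"
proof -
  \<comment> \<open>The induction needs the added term \<open>1 / (5 K ^ 5)\<close>, the integral of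
    \<open>x\<close> to the power \<open>- 6\<close> beyond \<open>K\<close>.\<close>
  have "(\<Sum>k = 1..K. 1 / real k ^ 6) + 1 / (5 * real K ^ 5) \<le> 101737 / 100000"
    using assms
  proof (induction K rule: dec_induct)
    case base
    have "{1..6} = {1, 2, 3, 4, 5, 6 :: nat}" by auto
    then show ?case by simp
  next
    case (step K)
    define x where "x = real K"
    have x: "6 \<le> x" using step.hyps by (simp add: x_def)
    have "(x + 1) ^ 6 - (x + 6) * x ^ 5 = 15 * x ^ 4 + 20 * x ^ 3 + 15 * x\<^sup>2 + 6 * x + 1" by algebra
    also have "\<dots> \<ge> 0" using x by simp
    finally have "(x + 6) * x ^ 5 \<le> (x + 1) ^ 6" by simp
    then have "(x + 6) / (5 * (x + 1) ^ 6) \<le> (x + 6) / (5 * ((x + 6) * x ^ 5))"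
      using x by (intro divide_left_mono mult_left_mono) auto
    also have "\<dots> = 1 / (5 * x ^ 5)" using x by simp
    also have "(x + 6) / (5 * (x + 1) ^ 6) = 1 / (x + 1) ^ 6 + 1 / (5 * (x + 1) ^ 5)"
      using x by (simp add: divide_simps power_numeral_reduce)
    finally have "1 / (x + 1) ^ 6 + 1 / (5 * (x + 1) ^ 5) \<le> 1 / (5 * x ^ 5)" .
    then have "(\<Sum>k = 1..K. 1 / real k ^ 6) + 1 / (x + 1) ^ 6 + 1 / (5 * (x + 1) ^ 5) \<le> 101737 / 100000"
      using step.IH unfolding x_def[symmetric] by linarith
    moreover have "(\<Sum>k = 1..Suc K. 1 / real k ^ 6) = (\<Sum>k = 1..K. 1 / real k ^ 6) + 1 / (x + 1) ^ 6"
      "real (Suc K) = x + 1"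
      by (simp_all add: x_def add.commute)
    ultimately show ?case by (simp only:)
  qed
  moreover have "0 \<le> 1 / (5 * real K ^ 5)" by simp
  ultimately show ?thesis by linarith
qed

lemma zeta_partial_ge:
  assumes "2 \<le> K"
  shows "1 + 1 / 2 ^ s \<le> (\<Sum>k = 1..K. 1 / real k ^ s)"
proof -
  have "(\<Sum>k\<in>{1, 2}. 1 / real k ^ s) \<le> (\<Sum>k = 1..K. 1 / real k ^ s)"
    by (rule sum_mono2) (use assms in auto)
  then show ?thesis by simp
qed

lemma sum_curv_pos:
  assumes uv: "0 \<le> u" "0 \<le> v" "v \<le> 1" and K: "10 \<le> K"
  shows "0 \<le> (\<Sum>(m, n)\<in>lattice_box K. curv 3 (1 + u) (1 - v) (of_int m) (of_int n))"
proof -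
  define Z where "Z = (\<Sum>k = 1..K. 1 / real k ^ 6)"
  have "1 + 1 / 2 ^ 6 \<le> Z" unfolding Z_def by (rule zeta_partial_ge) (use K in simp)
  then have "1 \<le> Z" by simp
  then have "1 * main3 u v \<le> Z * main3 u v"
    using main_pos(1)[OF uv] by (intro mult_right_mono) auto
  moreover have "- 11 / 5 \<le> sum (offcurv 3 u v) (offdiag K)" by (rule offcurv3_ge[OF uv]) (use K in simp)
  ultimately have "0 \<le> Z * main3 u v + sum (offcurv 3 u v) (offdiag K)" using main_pos(1)[OF uv] by linarith
  then show ?thesis unfolding sum_lattice_box_curv_3_6(1)[OF uv(1)] Z_def by simp
qed

text \<open>The budget closes here: at the hexagonal point
  \<open>3.06 * 0.62016 - 0.0548 < 1.846\<close>, while the slopes needed,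
  \<open>3.06 * 0.36 + 2\<close> and \<open>3.06 * 0.62 + 2\<close>, stay below \<open>3.5\<close>
  and \<open>4.5\<close>.\<close>

lemma sum_curv_ineq:
  assumes uv: "0 \<le> u" "0 \<le> v" "v \<le> 1" and y: "0 \<le> y" "y\<^sup>2 = (1 + u) - (1 - v)\<^sup>2 / 4" and K: "10 \<le> K"
  shows "3.06 * (\<Sum>(m, n)\<in>lattice_box K. curv 3 (1 + u) (1 - v) (of_int m) (of_int n))
    \<le> y ^ 3 * (\<Sum>(m, n)\<in>lattice_box K. curv 6 (1 + u) (1 - v) (of_int m) (of_int n))"
proof -
  define Z where "Z = (\<Sum>k = 1..K. 1 / real k ^ 6)"
  define W where "W = (\<Sum>k = 1..K. 1 / real k ^ 12)"
  define A where "A = sum (offcurv 3 u v) (offdiag K)"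
  define C where "C = sum (offcurv 6 u v) (offdiag K)"
  have e3: "(\<Sum>(m, n)\<in>lattice_box K. curv 3 (1 + u) (1 - v) (of_int m) (of_int n)) = 2 * (Z * main3 u v + A)"
    unfolding Z_def A_def by (rule sum_lattice_box_curv_3_6(1)[OF uv(1)])
  have e6: "(\<Sum>(m, n)\<in>lattice_box K. curv 6 (1 + u) (1 - v) (of_int m) (of_int n)) = 2 * (W * main6 u v + C)"
    unfolding W_def C_def by (rule sum_lattice_box_curv_3_6(2)[OF uv(1)])
  have Z: "Z \<le> 101737 / 100000" unfolding Z_def by (rule zeta_6_partial_le) (use K in simp)
  have W: "1 + 1 / 2 ^ 12 \<le> W" unfolding W_def by (rule zeta_partial_ge) (use K in simp)
  define g where "g = 1 + 2 * u + v - v\<^sup>2 / 2"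
  have g0: "0 \<le> g" using power_le_one[OF uv(2,3), of 2] uv by (simp add: g_def)
  have y3: "0.866025 * (3 / 4 * g) \<le> y ^ 3"
  proof -
    \<comment> \<open>the tangent to \<open>w powr (3/2)\<close> at a point just below \<open>w = 3/4\<close>\<close>
    define a :: real where "a = 0.866025"
    have "0 \<le> (y - a)\<^sup>2 * (y + a / 2)" using y by (simp add: a_def)
    also have "\<dots> = y ^ 3 - a * (3 / 2 * y\<^sup>2 - a\<^sup>2 / 2)" by (simp add: power_numeral_reduce algebra_simps)
    finally have "a * (3 / 2 * y\<^sup>2 - a\<^sup>2 / 2) \<le> y ^ 3" by simp
    moreover have "a * (3 / 2 * y\<^sup>2 - 3 / 8) \<le> a * (3 / 2 * y\<^sup>2 - a\<^sup>2 / 2)"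
      by (intro mult_left_mono) (auto simp: a_def power2_eq_square)
    moreover have "3 / 2 * y\<^sup>2 - 3 / 8 = 3 / 4 * g"
      unfolding y(2) g_def by (simp add: power2_eq_square field_simps)
    ultimately show ?thesis by (simp add: a_def)
  qed
  have "0.64967 * g \<le> 0.866025 * (3 / 4 * g) * (1 + 1 / 2 ^ 12)" using g0 by simp
  also have "\<dots> \<le> y ^ 3 * W" using y3 W g0 y by (intro mult_mono) auto
  finally have "0.64967 * g * main6 u v \<le> y ^ 3 * W * main6 u v"
    using main_pos(2)[OF uv] by (rule mult_right_mono)
  moreover have "3.06 * (Z * main3 u v) \<le> 3.1132 * main3 u v"
  proof -
    have "3.06 * Z * main3 u v \<le> 3.1132 * main3 u v"
      using Z main_pos(1)[OF uv] by (intro mult_right_mono) auto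
    then show ?thesis by (simp add: mult.assoc)
  qed
  moreover have "1.846 + 3.5 * u + 4.5 * v \<le> 0.64967 * g * main6 u v - 3.1132 * main3 u v"
    unfolding g_def by (rule main_ineq[OF uv])
  moreover have "A \<le> 0.62016 + 0.36 * u + 0.62 * v" unfolding A_def by (rule offcurv3_le[OF uv K])
  moreover have "0.0548 - 2 * (u + v) \<le> y ^ 3 * C"
    unfolding C_def by (rule offcurv6_ge[OF uv y]) (use K in simp)
  ultimately have "3.06 * (Z * main3 u v + A) \<le> y ^ 3 * W * main6 u v + y ^ 3 * C"
    using uv by simp
  then show ?thesis unfolding e3 e6 by (simp add: algebra_simps)
qed

section \<open>Monotonicity along rays\<close>

lemma deriv_inverse_power:
  fixes g :: "real \<Rightarrow> real"
  assumes "(g has_real_derivative g') (at t)" "g t \<noteq> 0"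
  shows "((\<lambda>t. 1 / g t ^ p) has_real_derivative - real p * g' / g t ^ (p + 1)) (at t)"
proof (cases p)
  case (Suc k)
  have "((\<lambda>t. inverse (g t) ^ Suc k) has_real_derivative
      real (Suc k) * (- (g' / (g t * g t)) * inverse (g t) ^ k)) (at t)"
    by (rule derivative_eq_intros refl assms)+ (simp add: assms field_simps)
  moreover have "real (Suc k) * (- (g' / (g t * g t)) * inverse (g t) ^ k) = - real p * g' / g t ^ (p + 1)"
    using assms(2) by (simp add: Suc field_simps)
  moreover have "(\<lambda>t. inverse (g t) ^ Suc k) = (\<lambda>t. 1 / g t ^ p)"
    by (simp add: Suc power_inverse inverse_eq_divide fun_eq_iff power_one_over)
  ultimately show ?thesis by simp
qed simp

text \<open>For \<open>z = exp t * (\<kappa> + \<i> s)\<close> with \<open>\<kappa>\<^sup>2 + s\<^sup>2 = 1\<close> we have \<open>Im z / |m z + n|\<^sup>2 = s / radial \<kappa> (m, n) t\<close>.\<close>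

definition radial :: "real \<Rightarrow> int \<times> int \<Rightarrow> real \<Rightarrow> real" where
  "radial \<kappa> = (\<lambda>(m, n) t. exp t * (of_int m)\<^sup>2 + exp (- t) * (of_int n)\<^sup>2 + 2 * \<kappa> * of_int m * of_int n)"

definition radial' :: "int \<times> int \<Rightarrow> real \<Rightarrow> real" where
  "radial' = (\<lambda>(m, n) t. exp t * (of_int m)\<^sup>2 - exp (- t) * (of_int n)\<^sup>2)"

definition radial'' :: "int \<times> int \<Rightarrow> real \<Rightarrow> real" where
  "radial'' = (\<lambda>(m, n) t. exp t * (of_int m)\<^sup>2 + exp (- t) * (of_int n)\<^sup>2)"

lemma radial_deriv:
  "(radial \<kappa> x has_real_derivative radial' x t) (at t)"
  "(radial' x has_real_derivative radial'' x t) (at t)"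
  by (cases x; auto simp: radial_def radial'_def radial''_def intro!: derivative_eq_intros)+

lemma radial_pos:
  assumes "x \<in> lattice_box K" "\<bar>\<kappa>\<bar> < 1"
  shows "0 < radial \<kappa> x t"
proof -
  obtain m n where x: "x = (m, n)" by (cases x)
  define a b where "a = exp (t / 2) * of_int m" and "b = exp (- t / 2) * (of_int n :: real)"
  have ab: "a * b = of_int m * of_int n"
    by (simp add: a_def b_def mult_ac exp_minus field_simps flip: exp_add)
  have sq: "a\<^sup>2 = exp t * (of_int m)\<^sup>2" "b\<^sup>2 = exp (- t) * (of_int n)\<^sup>2"
    by (simp_all add: a_def b_def power_mult_distrib flip: exp_of_nat_mult)
  have "m \<noteq> 0 \<or> n \<noteq> 0" using assms by (auto simp: x lattice_box_def)
  then have "a \<noteq> 0 \<or> b \<noteq> 0" by (auto simp: a_def b_def)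
  have r: "radial \<kappa> x t = (a + \<kappa> * b)\<^sup>2 + (1 - \<kappa>\<^sup>2) * b\<^sup>2"
  proof -
    have "radial \<kappa> x t = a\<^sup>2 + b\<^sup>2 + 2 * \<kappa> * (a * b)" unfolding ab sq by (simp add: x radial_def)
    then show ?thesis by (simp add: power2_eq_square algebra_simps)
  qed
  have k: "0 < 1 - \<kappa>\<^sup>2" using assms(2) by (simp add: abs_square_less_1)
  show ?thesis
  proof (cases "b = 0")
    case True
    then show ?thesis using \<open>a \<noteq> 0 \<or> b \<noteq> 0\<close> by (simp add: r)
  next
    case False
    then show ?thesis using k by (simp add: r add_nonneg_pos)
  qed
qed

text \<open>The two forms differ by the factor \<open>r\<close>, since the squared modulus of
  \<open>m z + n\<close> is \<open>r\<close> times \<open>radial\<close>; the net effect is the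
  power \<open>r ^ p\<close>.\<close>

lemma radial_curv:
  assumes "r = exp t"
  shows "real p * (real p + 1) * (radial' x t)\<^sup>2 / radial \<kappa> x t ^ (p + 2) - real p * radial'' x t / radial \<kappa> x t ^ (p + 1)
    = r ^ p * curv p (r\<^sup>2) (2 * \<kappa> * r) (of_int (fst x)) (of_int (snd x))"
proof -
  obtain m n where x: "x = (m, n)" by (cases x)
  have r: "0 < r" "r \<noteq> 0" "exp (- t) = 1 / r" using assms by (simp_all add: exp_minus field_simps)
  have e: "r\<^sup>2 * (of_int m)\<^sup>2 - (of_int n)\<^sup>2 = r * radial' x t"
    "r\<^sup>2 * (of_int m)\<^sup>2 + (of_int n)\<^sup>2 = r * radial'' x t"
    "r\<^sup>2 * (of_int m)\<^sup>2 + (of_int n)\<^sup>2 + 2 * \<kappa> * r * of_int m * of_int n = r * radial \<kappa> x t"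
    using r by (simp_all add: x radial_def radial'_def radial''_def r assms[symmetric] field_simps power2_eq_square)
  have "\<alpha> * D\<^sup>2 / N ^ (p + 2) - \<beta> * M / N ^ (p + 1)
      = r ^ p * (\<alpha> * (r * D)\<^sup>2 / (r * N) ^ (p + 2) - \<beta> * (r * M) / (r * N) ^ (p + 1))" for \<alpha> \<beta> D M N :: real
    using r by (simp add: power_mult_distrib power_add right_diff_distrib power2_eq_square mult_ac)
  then show ?thesis unfolding curv_def x fst_conv snd_conv e(3) unfolding e(1,2) x .
qed

lemma sum_swap_lattice_box: "(\<Sum>x\<in>lattice_box K. f (prod.swap x)) = (\<Sum>x\<in>lattice_box K. f x)"
  by (rule sum.reindex_bij_witness[of _ prod.swap prod.swap]) (auto simp: lattice_box_def)

lemma radial_monotone: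
  fixes b \<kappa> s T :: real
  assumes b: "b \<le> 3.06" and K: "10 \<le> K" and s: "0 < s" "\<kappa>\<^sup>2 + s\<^sup>2 = 1" and \<kappa>: "0 \<le> \<kappa>"
    and T: "0 \<le> T" "2 * \<kappa> * exp T \<le> 1"
  shows "(\<Sum>x\<in>lattice_box K. (s / radial \<kappa> x 0) ^ 6 - b * (s / radial \<kappa> x 0) ^ 3)
       \<le> (\<Sum>x\<in>lattice_box K. (s / radial \<kappa> x T) ^ 6 - b * (s / radial \<kappa> x T) ^ 3)"
proof -
  have "0 < s\<^sup>2" using s by simp
  then have "\<kappa>\<^sup>2 < 1" using s(2) by linarith
  then have k1: "\<bar>\<kappa>\<bar> < 1" by (simp add: abs_square_less_1)
  have N: "radial \<kappa> x t \<noteq> 0" if "x \<in> lattice_box K" for x t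
    using radial_pos[OF that k1, of t] by simp
  define F where "F t = (\<Sum>x\<in>lattice_box K. s ^ 6 * (1 / radial \<kappa> x t ^ 6) - b * s ^ 3 * (1 / radial \<kappa> x t ^ 3))" for t
  define F' where "F' t = (\<Sum>x\<in>lattice_box K. s ^ 6 * (- real 6 * radial' x t / radial \<kappa> x t ^ (6 + 1))
      - b * s ^ 3 * (- real 3 * radial' x t / radial \<kappa> x t ^ (3 + 1)))" for t
  define F'' where "F'' t = (\<Sum>x\<in>lattice_box K. s ^ 6 * (exp t ^ 6 * curv 6 ((exp t)\<^sup>2) (2 * \<kappa> * exp t) (of_int (fst x)) (of_int (snd x)))
      - b * s ^ 3 * (exp t ^ 3 * curv 3 ((exp t)\<^sup>2) (2 * \<kappa> * exp t) (of_int (fst x)) (of_int (snd x))))" for t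
  have d1: "(F has_real_derivative F' t) (at t)" for t
    unfolding F_def F'_def
    by (intro DERIV_sum DERIV_diff DERIV_cmult deriv_inverse_power radial_deriv N)
  have d: "((\<lambda>t. - real p * radial' x t / radial \<kappa> x t ^ (p + 1)) has_real_derivative
      exp t ^ p * curv p ((exp t)\<^sup>2) (2 * \<kappa> * exp t) (of_int (fst x)) (of_int (snd x))) (at t)"
    if "x \<in> lattice_box K" for x p t
  proof -
    have "((\<lambda>t. - real p * (radial' x t * (1 / radial \<kappa> x t ^ (p + 1)))) has_real_derivative
      - real p * (radial'' x t * (1 / radial \<kappa> x t ^ (p + 1))
        + - real (p + 1) * radial' x t / radial \<kappa> x t ^ (p + 1 + 1) * radial' x t)) (at t)"
      by (intro DERIV_cmult DERIV_mult deriv_inverse_power radial_deriv N that)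
    moreover have "- real p * (radial'' x t * (1 / radial \<kappa> x t ^ (p + 1))
        + - real (p + 1) * radial' x t / radial \<kappa> x t ^ (p + 1 + 1) * radial' x t)
      = real p * (real p + 1) * (radial' x t)\<^sup>2 / radial \<kappa> x t ^ (p + 2) - real p * radial'' x t / radial \<kappa> x t ^ (p + 1)"
      by (simp add: power2_eq_square algebra_simps)
    ultimately show ?thesis unfolding radial_curv[OF refl] by simp
  qed
  have d2: "(F' has_real_derivative F'' t) (at t)" for t
    unfolding F'_def F''_def by (intro DERIV_sum DERIV_diff DERIV_cmult d)
  have F''0: "0 \<le> F'' t" if t: "0 \<le> t" "t \<le> T" for t
  proof -
    define r where "r = exp t"
    have r: "1 \<le> r" "r \<le> exp T" using t by (simp_all add: r_def)
    define u v y where "u = r\<^sup>2 - 1" and "v = 1 - 2 * \<kappa> * r" and "y = s * r"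
    \<comment> \<open>Moving outward only lowers \<open>v\<close>, so the bound at the end of the
      ray keeps \<open>v >= 0\<close> throughout.\<close>
    have "2 * \<kappa> * r \<le> 2 * \<kappa> * exp T" using r \<kappa> by (intro mult_left_mono) auto
    then have uv: "0 \<le> u" "0 \<le> v" "v \<le> 1" using r \<kappa> T by (auto simp: u_def v_def)
    have y0: "0 \<le> y" using r s by (simp add: y_def)
    have y2: "y\<^sup>2 = (1 + u) - (1 - v)\<^sup>2 / 4"
    proof -
      have "s\<^sup>2 = 1 - \<kappa>\<^sup>2" using s by simp
      then show ?thesis by (simp add: y_def u_def v_def power_mult_distrib left_diff_distrib)
    qed
    define S3 where "S3 = (\<Sum>(m, n)\<in>lattice_box K. curv 3 (1 + u) (1 - v) (of_int m) (of_int n))"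
    define S6 where "S6 = (\<Sum>(m, n)\<in>lattice_box K. curv 6 (1 + u) (1 - v) (of_int m) (of_int n))"
    have S: "0 \<le> S3" "3.06 * S3 \<le> y ^ 3 * S6"
      unfolding S3_def S6_def by (rule sum_curv_pos[OF uv K], rule sum_curv_ineq[OF uv y0 y2 K])
    \<comment> \<open>Valid for negative \<open>b\<close> too, because
      \<open>S3 >= 0\<close>.\<close>
    have "b * S3 \<le> 3.06 * S3" using b S by (intro mult_right_mono) auto
    then have "0 \<le> y ^ 3 * (y ^ 3 * S6 - b * S3)" using S y0 by simp
    also have "\<dots> = F'' t"
      unfolding F''_def r_def[symmetric] S3_def S6_def
      by (simp add: sum_subtractf sum_distrib_left right_diff_distrib case_prod_unfold u_def v_def y_def
          power_mult_distrib mult_ac flip: power_add)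
    finally show ?thesis .
  qed
  have "F' 0 = 0"
  proof -
    have sw: "radial \<kappa> (prod.swap x) 0 = radial \<kappa> x 0" "radial' (prod.swap x) 0 = - radial' x 0" for x
      by (cases x; simp add: radial_def radial'_def)+
    have "F' 0 = (\<Sum>x\<in>lattice_box K. s ^ 6 * (- real 6 * radial' (prod.swap x) 0 / radial \<kappa> (prod.swap x) 0 ^ (6 + 1))
      - b * s ^ 3 * (- real 3 * radial' (prod.swap x) 0 / radial \<kappa> (prod.swap x) 0 ^ (3 + 1)))"
      unfolding F'_def by (rule sum_swap_lattice_box[symmetric])
    also have "\<dots> = - F' 0" unfolding F'_def sw by (simp add: sum_negf[symmetric])
    finally show ?thesis by simp
  qed
  have F'0: "0 \<le> F' t" if t: "0 \<le> t" "t \<le> T" for t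
  proof -
    have "F' 0 \<le> F' t"
      by (rule DERIV_nonneg_imp_nondecreasing[OF t(1)]) (use d2 F''0 t in force)
    then show ?thesis using \<open>F' 0 = 0\<close> by simp
  qed
  have "F 0 \<le> F T"
    by (rule DERIV_nonneg_imp_nondecreasing[OF T(1)]) (use d1 F'0 in force)
  then show ?thesis by (simp add: F_def power_divide)
qed

section \<open>The lattice sums\<close>

definition lattice_term :: "nat \<Rightarrow> int \<times> int \<Rightarrow> complex \<Rightarrow> real" where
  "lattice_term p = (\<lambda>(m, n) z. (Im z / (cmod (of_int m * z + of_int n))\<^sup>2) ^ p)"

lemma cmod_lattice_sq:
  "(cmod (of_int m * z + of_int n))\<^sup>2
    = (cmod z)\<^sup>2 * (of_int m)\<^sup>2 + (of_int n)\<^sup>2 + 2 * Re z * of_int m * of_int n"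
  unfolding cmod_power2 by (simp add: power2_eq_square algebra_simps)

text \<open>As \<open>2 * \<bar>Re z\<bar> <= 1\<close>, the cross term absorbs at most half of
  \<open>m^2 + n^2\<close>. This gives one majorant for summability and continuity.\<close>

lemma cmod_lattice_ge:
  assumes "1 \<le> cmod z" "\<bar>Re z\<bar> \<le> 1 / 2"
  shows "((of_int m)\<^sup>2 + (of_int n)\<^sup>2) / 2 \<le> (cmod (of_int m * z + of_int n))\<^sup>2"
proof -
  have "1 \<le> (cmod z)\<^sup>2" using assms by (simp add: one_le_power)
  then have 1: "1 * (of_int m)\<^sup>2 \<le> (cmod z)\<^sup>2 * (of_int m)\<^sup>2" by (intro mult_right_mono) auto
  have "\<bar>2 * Re z * of_int m * of_int n\<bar> = (2 * \<bar>Re z\<bar>) * \<bar>of_int m * of_int n\<bar>"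
    by (simp add: abs_mult mult_ac)
  also have "\<dots> \<le> 1 * \<bar>of_int m * of_int n\<bar>" using assms by (intro mult_right_mono) auto
  also have "\<dots> \<le> ((of_int m)\<^sup>2 + (of_int n)\<^sup>2) / 2"
  proof -
    have "0 \<le> (\<bar>of_int m\<bar> - \<bar>of_int n :: real\<bar>)\<^sup>2" by simp
    then show ?thesis by (simp add: power2_diff abs_mult)
  qed
  finally show ?thesis using 1 unfolding cmod_lattice_sq by (simp add: abs_le_iff field_simps)
qed

lemma finite_subset_lattice_box:
  assumes "F \<subseteq> UNIV - {(0, 0)}" "finite F"
  shows "\<exists>K\<ge>L. F \<subseteq> lattice_box K"
proof -
  define B where "B = Max (insert 0 ((\<lambda>(m, n). nat (max \<bar>m\<bar> \<bar>n\<bar>)) ` F))"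
  have "F \<subseteq> lattice_box (max L B)"
  proof
    fix x assume x: "x \<in> F"
    obtain m n where mn: "x = (m, n)" by (cases x)
    have "nat (max \<bar>m\<bar> \<bar>n\<bar>) \<le> B"
      unfolding B_def using x assms(2) mn by (intro Max_ge) force+
    then show "x \<in> lattice_box (max L B)" using x assms(1) mn by (auto simp: lattice_box_def)
  qed
  then show ?thesis by (intro exI[of _ "max L B"]) auto
qed

text \<open>For a nonnegative family bounded box sums are enough, as every finite set lies in a box;
  the shell estimate bounds them.\<close>

lemma summable_lattice:
  "(\<lambda>(m, n). 1 / ((of_int m)\<^sup>2 + (of_int n)\<^sup>2 :: real) ^ 3) summable_on (UNIV - {(0, 0)} :: (int \<times> int) set)"
proof (rule nonneg_bdd_above_summable_on)
  let ?f = "\<lambda>(m, n). 1 / ((of_int m)\<^sup>2 + (of_int n)\<^sup>2 :: real) ^ 3"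
  have bnd: "sum ?f (lattice_box K) \<le> 10" if K: "10 \<le> K" for K
  proof -
    define a where "a = (\<lambda>(j, k). 2 / ((real j)\<^sup>2 + (real k)\<^sup>2) ^ 3)"
    have "sum a (offdiag K) \<le> sum a (offdiag 1) + 2 / (2 * (real 1)\<^sup>2 * (real 1 + 1)\<^sup>2)"
    proof (rule sum_offdiag_le)
      fix j k :: nat assume jk: "1 \<le> j" "1 \<le> k" "j \<noteq> k" "1 < max j k"
      have "2 / ((real j)\<^sup>2 + (real k)\<^sup>2) ^ 3 \<le> (2 / 1 ^ 3) / real (max j k) ^ 6"
        by (rule inverse_cube_le) (use jk max_sq_le(2)[of j k] in auto)
      then show "a (j, k) \<le> 2 / real (max j k) ^ 6" by (simp add: a_def)
    qed (use K in auto)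
    then have o: "sum a (offdiag K) \<le> 1 / 4" by simp
    \<comment> \<open>The factor \<open>9/4\<close> is \<open>1 + 1\<close> from the axes and
      \<open>1/8 + 1/8\<close> from the diagonals.\<close>
    have "sum ?f (lattice_box K) = 2 * ((\<Sum>k = 1..K. 9 / 4 * (1 / real k ^ 6)) + sum a (offdiag K))"
      by (subst sum_lattice_box) (auto simp: a_def power_mult_distrib intro!: sum.cong simp flip: power_mult)
    also have "\<dots> = 2 * (9 / 4 * (\<Sum>k = 1..K. 1 / real k ^ 6) + sum a (offdiag K))"
      by (simp add: sum_distrib_left)
    also have "\<dots> \<le> 10" using zeta_6_partial_le[of K] K o by simp
    finally show ?thesis .
  qed
  show "bdd_above (sum ?f ` {F. F \<subseteq> UNIV - {(0, 0)} \<and> finite F})"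
  proof (rule bdd_aboveI2)
    fix F :: "(int \<times> int) set" assume "F \<in> {F. F \<subseteq> UNIV - {(0, 0)} \<and> finite F}"
    then have F: "F \<subseteq> UNIV - {(0, 0)}" "finite F" by auto
    obtain K where K: "10 \<le> K" "F \<subseteq> lattice_box K"
      using finite_subset_lattice_box[OF F] by blast
    have "sum ?f F \<le> sum ?f (lattice_box K)" by (rule sum_mono2) (use K in auto)
    then show "sum ?f F \<le> 10" using bnd[OF K(1)] by linarith
  qed
qed auto

lemma lattice_term_le:
  assumes "1 \<le> cmod z" "\<bar>Re z\<bar> \<le> 1 / 2" "0 \<le> Im z" "3 \<le> p" "x \<in> UNIV - {(0, 0)}"
  shows "0 \<le> lattice_term p x z"
    and "lattice_term p x z \<le> (2 * Im z) ^ p * (case x of (m, n) \<Rightarrow> 1 / ((of_int m)\<^sup>2 + (of_int n)\<^sup>2) ^ 3)"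
proof -
  obtain m n where x: "x = (m, n)" by (cases x)
  define q where "q = ((of_int m)\<^sup>2 + (of_int n)\<^sup>2 :: real)"
  have "m \<noteq> 0 \<or> n \<noteq> 0" using assms(5) x by auto
  then have "1 \<le> m\<^sup>2 + n\<^sup>2"
    by (smt (verit) zero_le_power2 zero_less_power2)
  then have "real_of_int 1 \<le> real_of_int (m\<^sup>2 + n\<^sup>2)" by (simp only: of_int_le_iff)
  then have q: "1 \<le> q" by (simp add: q_def)
  have g: "q / 2 \<le> (cmod (of_int m * z + of_int n))\<^sup>2"
    unfolding q_def by (rule cmod_lattice_ge[OF assms(1,2)])
  show "0 \<le> lattice_term p x z" using assms(3) by (simp add: lattice_term_def x)
  have "0 < (cmod (of_int m * z + of_int n))\<^sup>2" using g q by linarith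
  then have "Im z / (cmod (of_int m * z + of_int n))\<^sup>2 \<le> Im z / (q / 2)"
    using g q assms(3) by (intro divide_left_mono mult_pos_pos) auto
  then have "lattice_term p x z \<le> (Im z / (q / 2)) ^ p"
    unfolding lattice_term_def x prod.case using assms(3) by (intro power_mono) auto
  also have "\<dots> = (2 * Im z) ^ p * (1 / q ^ p)" by (simp add: power_divide mult.commute)
  also have "\<dots> \<le> (2 * Im z) ^ p * (1 / q ^ 3)"
    using q assms(3,4) by (intro mult_left_mono divide_left_mono power_increasing) auto
  finally show "lattice_term p x z \<le> (2 * Im z) ^ p * (case x of (m, n) \<Rightarrow> 1 / ((of_int m)\<^sup>2 + (of_int n)\<^sup>2) ^ 3)"
    by (simp add: x q_def)
qed

lemma lattice_zeta_eq:
  assumes "1 \<le> cmod z" "\<bar>Re z\<bar> \<le> 1 / 2" "0 < Im z"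
  shows "lattice_zeta (real p) z = (\<Sum>\<^sub>\<infinity>x\<in>UNIV - {(0, 0)}. lattice_term p x z)"
  unfolding lattice_zeta_def
proof (rule infsum_cong)
  fix x :: "int \<times> int" assume "x \<in> UNIV - {(0, 0)}"
  then obtain m n where x: "x = (m, n)" "m \<noteq> 0 \<or> n \<noteq> 0" by (cases x) auto
  define c where "c = cmod (of_int m * z + of_int n)"
  have "0 < ((of_int m)\<^sup>2 + (of_int n)\<^sup>2 :: real) / 2" using x(2) by (simp add: sum_power2_gt_zero_iff)
  then have "0 < c\<^sup>2" using cmod_lattice_ge[OF assms(1,2), of m n] unfolding c_def by linarith
  then have c: "0 < c" by (simp add: c_def)
  have "c powr (2 * real p) = c ^ (2 * p)" using c powr_realpow[of c "2 * p"] by simp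
  then have "Im z powr real p / c powr (2 * real p) = (Im z / c\<^sup>2) ^ p"
    using assms(3) c by (simp add: powr_realpow power_divide power_mult)
  then show "(case x of (m, n) \<Rightarrow> Im z powr real p / cmod (of_int m * z + of_int n) powr (2 * real p)) = lattice_term p x z"
    by (simp add: x lattice_term_def c_def)
qed

lemma lattice_zeta_tendsto:
  assumes z: "1 \<le> cmod z" "\<bar>Re z\<bar> \<le> 1 / 2" "0 < Im z" and p: "3 \<le> p"
  shows "(\<lambda>K. \<Sum>x\<in>lattice_box K. lattice_term p x z) \<longlonglongrightarrow> lattice_zeta (real p) z"
proof -
  have "(\<lambda>x. lattice_term p x z) summable_on (UNIV - {(0, 0)})"
    by (rule summable_on_comparison_test[OF summable_on_cmult_right[OF summable_lattice, of "(2 * Im z) ^ p"]])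
       (use lattice_term_le[OF z(1,2) _ p] z in auto)
  then have "((\<lambda>x. lattice_term p x z) has_sum lattice_zeta (real p) z) (UNIV - {(0, 0)})"
    unfolding lattice_zeta_eq[OF z] by (rule has_sum_infsum)
  then have "(sum (\<lambda>x. lattice_term p x z) \<longlongrightarrow> lattice_zeta (real p) z) (finite_subsets_at_top (UNIV - {(0, 0)}))"
    by (simp add: has_sum_def)
  moreover have "filterlim lattice_box (finite_subsets_at_top (UNIV - {(0, 0)})) sequentially"
    unfolding filterlim_finite_subsets_at_top
  proof safe
    fix X :: "(int \<times> int) set" assume "finite X" "X \<subseteq> UNIV - {(0, 0)}"
    then obtain K0 where X: "X \<subseteq> lattice_box K0" using finite_subset_lattice_box by metis
    show "\<forall>\<^sub>F K in sequentially. finite (lattice_box K) \<and> X \<subseteq> lattice_box K \<and> lattice_box K \<subseteq> UNIV - {(0, 0)}"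
      using eventually_ge_at_top[of K0]
    proof eventually_elim
      case (elim K)
      then have "lattice_box K0 \<subseteq> lattice_box K" by (auto simp: lattice_box_def)
      moreover have "lattice_box K \<subseteq> UNIV - {(0, 0)}" by (auto simp: lattice_box_def)
      ultimately show ?case using X by simp
    qed
  qed
  ultimately show ?thesis by (rule filterlim_compose)
qed

text \<open>The bound on \<open>Im z\<close> makes the majorant uniform, as the Weierstrass test
  requires. Continuity serves to attain the minimum on the arc.\<close>

lemma continuous_on_lattice_zeta:
  assumes S: "\<And>z. z \<in> S \<Longrightarrow> 1 \<le> cmod z \<and> \<bar>Re z\<bar> \<le> 1 / 2 \<and> 0 < Im z \<and> Im z \<le> 1" and p: "3 \<le> p"
  shows "continuous_on S (lattice_zeta (real p))"
proof -
  let ?X = "UNIV - {(0, 0)} :: (int \<times> int) set"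
  have ul: "uniform_limit S (\<lambda>X z. \<Sum>x\<in>X. lattice_term p x z) (\<lambda>z. \<Sum>\<^sub>\<infinity>x\<in>?X. lattice_term p x z) (finite_subsets_at_top ?X)"
  proof (rule Weierstrass_m_test_general)
    fix x :: "int \<times> int" and z assume x: "x \<in> ?X" and "z \<in> S"
    then have z: "1 \<le> cmod z" "\<bar>Re z\<bar> \<le> 1 / 2" "0 \<le> Im z" "Im z \<le> 1" using S[of z] by auto
    have "norm (lattice_term p x z) \<le> (2 * Im z) ^ p * (case x of (m, n) \<Rightarrow> 1 / ((of_int m)\<^sup>2 + (of_int n)\<^sup>2) ^ 3)"
      using lattice_term_le[OF z(1-3) p x] by simp
    also have "\<dots> \<le> 2 ^ p * (case x of (m, n) \<Rightarrow> 1 / ((of_int m)\<^sup>2 + (of_int n)\<^sup>2) ^ 3)"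
      using z by (intro mult_right_mono power_mono) (auto split: prod.split)
    finally show "norm (lattice_term p x z) \<le> 2 ^ p * (case x of (m, n) \<Rightarrow> 1 / ((of_int m)\<^sup>2 + (of_int n)\<^sup>2) ^ 3)" .
  qed (rule summable_on_cmult_right[OF summable_lattice])
  have ev: "\<forall>\<^sub>F X in finite_subsets_at_top ?X. continuous_on S (\<lambda>z. \<Sum>x\<in>X. lattice_term p x z)"
  proof (rule eventually_finite_subsets_at_top_weakI)
    fix X assume X: "finite X" "X \<subseteq> ?X"
    show "continuous_on S (\<lambda>z. \<Sum>x\<in>X. lattice_term p x z)"
    proof (rule continuous_on_sum)
      fix x assume "x \<in> X"
      then obtain m n where x: "x = (m, n)" "m \<noteq> 0 \<or> n \<noteq> 0" using X by (cases x) auto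
      have "of_int m * z + of_int n \<noteq> 0" if "z \<in> S" for z
      proof
        assume "of_int m * z + of_int n = 0"
        then have "((of_int m)\<^sup>2 + (of_int n)\<^sup>2 :: real) / 2 \<le> 0"
          using cmod_lattice_ge[of z m n] S[OF that] by simp
        then show False using x(2) by (simp add: sum_power2_le_zero_iff)
      qed
      then show "continuous_on S (lattice_term p x)"
        unfolding lattice_term_def x prod.case by (intro continuous_intros) auto
    qed
  qed
  have "continuous_on S (lattice_zeta (real p)) \<longleftrightarrow> continuous_on S (\<lambda>z. \<Sum>\<^sub>\<infinity>x\<in>?X. lattice_term p x z)"
    by (rule continuous_on_cong) (use lattice_zeta_eq S in auto)
  then show ?thesis using uniform_limit_theorem[OF ev ul] by simp
qed

lemma lattice_zeta_reflect:
  assumes z: "1 \<le> cmod z" "\<bar>Re z\<bar> \<le> 1 / 2" "0 < Im z"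
  shows "lattice_zeta (real p) (- cnj z) = lattice_zeta (real p) z"
proof -
  have z': "1 \<le> cmod (- cnj z)" "\<bar>Re (- cnj z)\<bar> \<le> 1 / 2" "0 < Im (- cnj z)" using z by auto
  show ?thesis
    unfolding lattice_zeta_eq[OF z] lattice_zeta_eq[OF z']
    by (rule infsum_reindex_bij_witness[of _ "\<lambda>(m, n). (- m, n)" "\<lambda>(m, n). (- m, n)"])
       (auto simp: lattice_term_def cmod_lattice_sq)
qed

lemma lattice_zeta_radial_le:
  fixes b :: real and z :: complex
  assumes b: "b \<le> 3.06" and z: "1 \<le> cmod z" "0 \<le> Re z" "Re z \<le> 1 / 2" "0 < Im z"
  defines "w \<equiv> z / of_real (cmod z)"
  shows "lattice_zeta 6 w - b * lattice_zeta 3 w \<le> lattice_zeta 6 z - b * lattice_zeta 3 z"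
proof -
  define R where "R = cmod z"
  define \<kappa> s where "\<kappa> = Re z / R" and "s = Im z / R"
  have "1 \<le> R" using z by (simp add: R_def)
  then have R: "1 \<le> R" "0 < R" "exp (ln R) = R" by simp_all
  have s: "0 < s" using z R by (simp add: s_def)
  have k: "0 \<le> \<kappa>" using z R by (simp add: \<kappa>_def)
  have "(Re z)\<^sup>2 + (Im z)\<^sup>2 = R\<^sup>2" by (simp add: R_def cmod_power2)
  then have ks: "\<kappa>\<^sup>2 + s\<^sup>2 = 1" using R by (simp add: \<kappa>_def s_def power_divide add_divide_distrib[symmetric])
  have kR: "2 * \<kappa> * exp (ln R) \<le> 1" using z R by (simp add: \<kappa>_def)
  have kz: "\<kappa> \<le> Re z" using z R by (simp add: \<kappa>_def divide_le_eq mult_left_le_one_le mult_le_cancel_left1)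
  have w: "Re w = \<kappa>" "Im w = s" "cmod w = 1"
    using R by (simp_all add: w_def \<kappa>_def s_def R_def[symmetric] norm_divide)
  have w': "1 \<le> cmod w" "\<bar>Re w\<bar> \<le> 1 / 2" "0 < Im w" using w k kz s z by auto
  have z': "1 \<le> cmod z" "\<bar>Re z\<bar> \<le> 1 / 2" "0 < Im z" using z by auto
  have tz: "lattice_term p x z = (s / radial \<kappa> x (ln R)) ^ p" for p x
  proof -
    obtain m n where x: "x = (m, n)" by (cases x)
    have "(cmod (of_int m * z + of_int n))\<^sup>2 = R * radial \<kappa> x (ln R)"
      unfolding cmod_lattice_sq R_def[symmetric] using R
      by (simp add: x radial_def exp_minus \<kappa>_def field_simps power2_eq_square)
    then show ?thesis using R by (simp add: lattice_term_def x s_def)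
  qed
  have tw: "lattice_term p x w = (s / radial \<kappa> x 0) ^ p" for p x
  proof -
    obtain m n where x: "x = (m, n)" by (cases x)
    have "(cmod (of_int m * w + of_int n))\<^sup>2 = radial \<kappa> x 0"
      unfolding cmod_lattice_sq w by (simp add: x radial_def)
    then show ?thesis by (simp add: lattice_term_def x w)
  qed
  have L: "(\<lambda>K. \<Sum>x\<in>lattice_box K. lattice_term 6 x v - b * lattice_term 3 x v)
      \<longlonglongrightarrow> lattice_zeta 6 v - b * lattice_zeta 3 v"
    if "1 \<le> cmod v" "\<bar>Re v\<bar> \<le> 1 / 2" "0 < Im v" for v
  proof -
    have "(\<lambda>K. (\<Sum>x\<in>lattice_box K. lattice_term 6 x v) - b * (\<Sum>x\<in>lattice_box K. lattice_term 3 x v))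
      \<longlonglongrightarrow> lattice_zeta (real 6) v - b * lattice_zeta (real 3) v"
      by (intro tendsto_intros lattice_zeta_tendsto that) auto
    then show ?thesis by (simp add: sum_subtractf sum_distrib_left)
  qed
  show ?thesis
  proof (rule LIMSEQ_le[OF L[OF w'] L[OF z']])
    show "\<exists>N. \<forall>n\<ge>N. (\<Sum>x\<in>lattice_box n. lattice_term 6 x w - b * lattice_term 3 x w)
        \<le> (\<Sum>x\<in>lattice_box n. lattice_term 6 x z - b * lattice_term 3 x z)"
      unfolding tz tw using radial_monotone[OF b _ s ks k _ kR] R by (intro exI[of _ 10]) auto
  qed
qed

section \<open>The domain and the arc\<close>

lemma closure_D_G_subset: "closure D_G \<subseteq> {z. 1 \<le> cmod z \<and> 0 \<le> Re z \<and> Re z \<le> 1 / 2 \<and> 0 \<le> Im z}"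
proof (rule closure_minimal)
  have "closed ({z. 1 \<le> cmod z} \<inter> {z. 0 \<le> Re z} \<inter> {z. Re z \<le> 1 / 2} \<inter> {z. 0 \<le> Im z})"
    by (intro closed_Int closed_Collect_le continuous_intros)
  then show "closed {z. 1 \<le> cmod z \<and> 0 \<le> Re z \<and> Re z \<le> 1 / 2 \<and> 0 \<le> Im z}"
    by (simp add: Collect_conj_eq Int_assoc)
qed (auto simp: D_G_def)

text \<open>The square of \<open>Im z\<close> is at least \<open>(cmod z)^2 - 1/4\<close>, hence at
  least \<open>3/4 * (cmod z)^2\<close>. This excludes real points from the closure and places
  \<open>z / cmod z\<close> on the arc.\<close>

lemma Im_ge_of_strip:
  assumes "1 \<le> cmod z" "\<bar>Re z\<bar> \<le> 1 / 2" "0 \<le> Im z"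
  shows "sqrt 3 / 2 * cmod z \<le> Im z"
proof (rule power2_le_imp_le)
  have "(Re z)\<^sup>2 \<le> (1 / 2)\<^sup>2" using assms(2) by (metis abs_ge_zero power2_abs power_mono)
  moreover have "1 \<le> (cmod z)\<^sup>2" using assms(1) by (simp add: one_le_power)
  ultimately show "(sqrt 3 / 2 * cmod z)\<^sup>2 \<le> (Im z)\<^sup>2"
    by (simp add: power_mult_distrib power_divide cmod_power2 power2_eq_square[of "1 / 2"])
qed (use assms in auto)

text \<open>The open domain contains no point of the arc, so each point, endpoints included, is
  pushed along the segment towards the interior point \<open>1/4 + 2 i\<close>.\<close>

lemma Gamma_b_half_subset_closure:
  assumes "z \<in> Gamma_b" "0 \<le> Re z"
  shows "z \<in> closure D_G"
  unfolding closure_approachable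
proof (intro allI impI)
  fix e :: real assume e: "0 < e"
  have z: "cmod z = 1" "sqrt 3 / 2 \<le> Im z" "0 < Im z" using assms by (auto simp: Gamma_b_def)
  have n: "(Re z)\<^sup>2 + (Im z)\<^sup>2 = 1" using z(1) cmod_power2[of z] by simp
  have "(sqrt 3 / 2)\<^sup>2 \<le> (Im z)\<^sup>2" using z by (intro power_mono) auto
  then have i: "3 / 4 \<le> (Im z)\<^sup>2" by (simp add: power_divide)
  then have "(Re z)\<^sup>2 \<le> (1 / 2)\<^sup>2" using n by (simp add: power_divide)
  then have re: "Re z \<le> 1 / 2" by (rule power2_le_imp_le) simp
  have im: "1 / 2 < Im z"
  proof (rule power_less_imp_less_base)
    show "(1 / 2)\<^sup>2 < (Im z)\<^sup>2" using i by (simp add: power_divide)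
  qed (use z in auto)
  define d where "d = min (1 / 2) (e / 4)"
  have d: "0 < d" "d < 1" "d * 3 < e" using e by (auto simp: d_def min_def)
  define c where "c = Complex (1 / 4) 2"
  define y where "y = z + of_real d * (c - z)"
  have yr: "Re y = (1 - d) * Re z + d / 4" "Im y = (1 - d) * Im z + 2 * d"
    by (simp_all add: y_def c_def algebra_simps)
  have "cmod (c - z) \<le> \<bar>Re (c - z)\<bar> + \<bar>Im (c - z)\<bar>" by (rule cmod_le)
  also have "\<dots> \<le> 1 / 4 + 2"
  proof (rule add_mono)
    show "\<bar>Re (c - z)\<bar> \<le> 1 / 4" unfolding c_def using re assms(2) by (auto simp: abs_if)
    have "Im z \<le> 1" using z(1) abs_Im_le_cmod[of z] by simp
    then show "\<bar>Im (c - z)\<bar> \<le> 2" using im by (simp add: c_def)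
  qed
  finally have "d * cmod (c - z) \<le> d * 3" using d by (intro mult_left_mono) auto
  then have "d * cmod (c - z) < e" using d(3) by linarith
  moreover have "dist y z = d * cmod (c - z)" using d by (simp add: y_def dist_norm norm_mult)
  ultimately have "dist y z < e" by simp
  moreover have "y \<in> D_G"
  proof -
    have "(1 - d) * Re z \<le> (1 - d) * (1 / 2)" using re d by (intro mult_left_mono) auto
    then have "Re y < 1 / 2" using d unfolding yr by (simp add: algebra_simps)
    moreover have "0 < Re y" using d assms(2) unfolding yr by (intro add_nonneg_pos) auto
    moreover have "0 < Im y" using d z unfolding yr by (intro add_pos_pos) auto
    moreover have "1 < cmod y"
    proof -
      have "(1 - d) * Re z \<le> Re y" "0 \<le> (1 - d) * Re z" using d assms(2) by (simp_all add: yr)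
      then have 1: "((1 - d) * Re z)\<^sup>2 \<le> (Re y)\<^sup>2" by (intro power_mono)
      \<comment> \<open>The exterior of the disc is not convex, but \<open>Im c = 2\<close> and
        \<open>Im z > 1/2\<close> make the cross term at least \<open>2 * P\<close>, just enough to
        complete the square to \<open>1\<close>.\<close>
      define P where "P = d * (1 - d)"
      have "(Im y)\<^sup>2 = ((1 - d) * Im z)\<^sup>2 + 4 * (P * Im z) + 4 * d\<^sup>2"
        unfolding yr P_def by (simp add: power2_eq_square algebra_simps)
      moreover have "P * (1 / 2) \<le> P * Im z"
        unfolding P_def using im d by (intro mult_left_mono) auto
      moreover have "((1 - d) * Re z)\<^sup>2 + ((1 - d) * Im z)\<^sup>2 = (1 - d)\<^sup>2"
        using n by (simp add: power_mult_distrib distrib_left[symmetric])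
      moreover have "(1 - d)\<^sup>2 + 2 * P + d\<^sup>2 = 1"
        unfolding P_def by (simp add: power2_eq_square algebra_simps)
      moreover have "0 < d\<^sup>2" using d by simp
      ultimately have "1 < (Re y)\<^sup>2 + (Im y)\<^sup>2" using 1 by linarith
      then have "1\<^sup>2 < (cmod y)\<^sup>2" by (simp add: cmod_power2)
      then show ?thesis by (rule power_less_imp_less_base) simp
    qed
    ultimately show ?thesis by (simp add: D_G_def)
  qed
  ultimately show "\<exists>y\<in>D_G. dist y z < e" by blast
qed

lemma Gamma_b_strip:
  assumes "z \<in> Gamma_b"
  shows "1 \<le> cmod z" "\<bar>Re z\<bar> \<le> 1 / 2" "0 < Im z" "Im z \<le> 1"
proof -
  have z: "cmod z = 1" "sqrt 3 / 2 \<le> Im z" using assms by (auto simp: Gamma_b_def)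
  have "(sqrt 3 / 2)\<^sup>2 \<le> (Im z)\<^sup>2" using z by (intro power_mono) auto
  then have "(Re z)\<^sup>2 \<le> (1 / 2)\<^sup>2" using z(1) cmod_power2[of z] by (simp add: power_divide)
  then show "\<bar>Re z\<bar> \<le> 1 / 2" using abs_le_square_iff[of "Re z" "1 / 2"] by simp
qed (use assms in \<open>auto simp: Gamma_b_def\<close>)

lemma compact_Gamma_b: "compact Gamma_b"
proof -
  have "Gamma_b = sphere 0 1 \<inter> {z. sqrt 3 / 2 \<le> Im z}"
  proof (intro set_eqI iffI)
    fix z assume z: "z \<in> sphere 0 1 \<inter> {z. sqrt 3 / 2 \<le> Im z}"
    then have "0 < Im z" by (auto intro: less_le_trans[of 0 "sqrt 3 / 2"])
    moreover have "Im z \<le> 1" using z abs_Im_le_cmod[of z] by simp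
    ultimately show "z \<in> Gamma_b" using z by (simp add: Gamma_b_def)
  qed (auto simp: Gamma_b_def)
  moreover have "closed {z. sqrt 3 / 2 \<le> Im z}" by (intro closed_Collect_le continuous_intros)
  ultimately show ?thesis using compact_Int_closed[OF compact_sphere] by metis
qed

theorem theorem4p1:
  fixes b :: real
  assumes "b \<le> 3.06"
  defines "f \<equiv> (\<lambda>z. lattice_zeta 6 z - b * lattice_zeta 3 z)"
  shows "(\<exists>z\<in>closure D_G. \<forall>w\<in>closure D_G. f z \<le> f w)
       \<and> (\<exists>z\<in>Gamma_b. \<forall>w\<in>Gamma_b. f z \<le> f w)
       \<and> (INF z\<in>closure D_G. f z) = (INF z\<in>Gamma_b. f z)"
proof -
  have "continuous_on Gamma_b (lattice_zeta (real 6))" "continuous_on Gamma_b (lattice_zeta (real 3))"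
    by (rule continuous_on_lattice_zeta; use Gamma_b_strip in auto)+
  then have cont: "continuous_on Gamma_b f" unfolding f_def by (auto intro!: continuous_intros)
  have "\<i> \<in> Gamma_b" by (simp add: Gamma_b_def real_le_lsqrt)
  then have "Gamma_b \<noteq> {}" by blast
  from continuous_attains_inf[OF compact_Gamma_b this cont]
  obtain z0 where z0: "z0 \<in> Gamma_b" "\<And>w. w \<in> Gamma_b \<Longrightarrow> f z0 \<le> f w" by blast
  \<comment> \<open>\<open>Gamma_b\<close> also contains the half of the arc with
    \<open>Re z < 0\<close>, which the closure of \<open>D_G\<close> does not meet; reflection moves
    the minimiser into the other half.\<close>
  define z1 where "z1 = (if 0 \<le> Re z0 then z0 else - cnj z0)"
  have z1: "z1 \<in> closure D_G"
    by (rule Gamma_b_half_subset_closure) (use z0 in \<open>auto simp: z1_def Gamma_b_def\<close>)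
  have fz1: "f z1 = f z0"
    using lattice_zeta_reflect[OF Gamma_b_strip(1-3)[OF z0(1)], of 6]
      lattice_zeta_reflect[OF Gamma_b_strip(1-3)[OF z0(1)], of 3]
    by (simp add: z1_def f_def)
  have le: "f z0 \<le> f w" if w: "w \<in> closure D_G" for w
  proof -
    have w: "1 \<le> cmod w" "0 \<le> Re w" "Re w \<le> 1 / 2" "0 \<le> Im w" using closure_D_G_subset w by auto
    then have i: "sqrt 3 / 2 * cmod w \<le> Im w" by (intro Im_ge_of_strip) auto
    moreover have c0: "0 < cmod w" using w(1) by linarith
    moreover have "0 < sqrt 3 / 2 * cmod w" using c0 by simp
    ultimately have w0: "0 < Im w" by linarith
    have "sqrt 3 / 2 \<le> Im w / cmod w" using i c0 by (simp only: pos_le_divide_eq)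
    moreover have "Im w / cmod w \<le> 1" using c0 abs_Im_le_cmod[of w] by (simp only: pos_divide_le_eq)
    moreover have "0 < Im w / cmod w" using c0 w0 by (rule divide_pos_pos[rotated])
    moreover have "cmod (w / of_real (cmod w)) = 1" using c0 by (simp add: norm_divide)
    ultimately have "w / of_real (cmod w) \<in> Gamma_b" by (simp add: Gamma_b_def)
    then have "f z0 \<le> f (w / of_real (cmod w))" by (rule z0)
    also have "\<dots> \<le> f w"
      unfolding f_def by (rule lattice_zeta_radial_le) (use assms(1) w w0 in auto)
    finally show ?thesis .
  qed
  have "(INF z\<in>closure D_G. f z) = f z1"
    by (rule cInf_eq_minimum) (use imageI[OF z1, of f] le fz1 in auto)
  moreover have "(INF z\<in>Gamma_b. f z) = f z0"
    by (rule cInf_eq_minimum) (use z0 in auto)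
  moreover have "\<exists>z\<in>closure D_G. \<forall>w\<in>closure D_G. f z \<le> f w"
    by (rule bexI[OF _ z1]) (use le fz1 in auto)
  moreover have "\<exists>z\<in>Gamma_b. \<forall>w\<in>Gamma_b. f z \<le> f w"
    by (rule bexI[OF _ z0(1)]) (use z0(2) in auto)
  ultimately show ?thesis using fz1 by simp
qed

end
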